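(* Let $\tau=(\Lambda,\Gamma)$ be an indecomposable Tutte constellation with $\Gamma\ne\emptyset$ and $\Gamma\neq\Lambda$. Then $H_0(\Sigma_1^\tau,\mathbb Z)\simeq\mathbb Z$.
   Context: Matroids are on finite ground sets. For a matroid $M$ on $E$, $\Lambda_M$ is its lattice of flats, $\langle S\rangle$ the closure of $S$, $F_1\vee F_2=\langle F_1\cup F_2\rangle$; the corank of a flat $F$ is $\mathrm{rk}(M)-\mathrm{rk}(F)$. A modular cut in a geometric lattice $\Lambda=\Lambda_M$ is a subset $\Gamma\subseteq\Lambda$ closed under passing to larger flats and such that $F_1\cap F_2\in\Gamma$ whenever $F_1,F_2\in\Gamma$ satisfy $\mathrm{rk}(F_1)+\mathrm{rk}(F_2)=\mathrm{rk}(F_1\cap F_2)+\mathrm{rk}(F_1\vee F_2)$. A Tutte constellation is a pair $\tau=(\Lambda,\Gamma)$ of a geometric lattice $\Lambda$ and a modular cut $\Gamma$ in $\Lambda$; its type is the isomorphism type of the simple matroid $M$ (with ground set $E$) whose lattice of flats is $\Lambda$. It is indecomposable if $M$ is connected. A flat $F$ is indecomposable in $\Lambda$ if $M/F$ is connected. An upper sublattice of $\Lambda=\Lambda_M$ is a subset of the form $\{\langle S\rangle:I\subseteq S\subseteq E-J\}$ for disjoint $I,J\subseteq E$ with $I$ independent and $E-J$ spanning, ordered by inclusion (equivalently: a subset that is a geometric lattice under inclusion, has the same joins as $\Lambda$, and whose rank equals the corank in $\Lambda$ of its bottom element). A subconstellation $\sigma$ of $\tau$ is a pair $(\Lambda_\sigma,\Gamma_\sigma)$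 with $\Lambda_\sigma$ an upper sublattice of $\Lambda$ and $\Gamma_\sigma=\Gamma\cap\Lambda_\sigma$; subconstellations are ordered by inclusion of lattices. A subconstellation of class 0 is one of type $U_{1,1}$ with $\Gamma_\sigma=\{E\}$ (so $\Lambda_\sigma=\{H,E\}$ for a hyperplane $H\notin\Gamma$). A subconstellation of class 1 is one of type $U_{2,2}$ with $\Gamma_\sigma=\{E\}$ such that the bottom element of $\Lambda_\sigma$ is an indecomposable flat of $\Lambda$. $\mathcal X_1^\tau$ is the poset of all subconstellations of $\tau$ of class 0 or 1, and $\Sigma_1^\tau$ is its order complex, i.e. the simplicial complex whose vertices are the elements of $\mathcal X^\tau_1$ and whose faces are the finite chains. $H_0(-,\mathbb Z)$ denotes singular homology (of the geometric realization). *)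

theory Defs
  imports "HOL-Homology.Homology"
begin

section \<open>Matroids\<close>

record 'a matroid_data =
  ground :: "'a set"
  indep :: "'a set set"

definition matroid :: "'a matroid_data \<Rightarrow> bool" where
  "matroid M \<longleftrightarrow>
     finite (ground M) \<and>
     indep M \<subseteq> Pow (ground M) \<and>
     {} \<in> indep M \<and>
     (\<forall>I\<in>indep M. \<forall>J. J \<subseteq> I \<longrightarrow> J \<in> indep M) \<and>
     (\<forall>I\<in>indep M. \<forall>J\<in>indep M. card I < card J \<longrightarrow> (\<exists>e\<in>J - I. insert e I \<in> indep M))"

text \<open>No loops and no parallel pairs.\<close>

definition simple_matroid :: "'a matroid_data \<Rightarrow> bool" where
  "simple_matroid M \<longleftrightarrow>
     matroid M \<and> (\<forall>X. X \<subseteq> ground M \<and> card X \<le> 2 \<longrightarrow> X \<in> indep M)"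

definition basis_in :: "'a matroid_data \<Rightarrow> 'a set \<Rightarrow> 'a set \<Rightarrow> bool" where
  "basis_in M X B \<longleftrightarrow>
     B \<in> indep M \<and> B \<subseteq> X \<and> (\<forall>I\<in>indep M. B \<subseteq> I \<and> I \<subseteq> X \<longrightarrow> I = B)"

definition mrank :: "'a matroid_data \<Rightarrow> 'a set \<Rightarrow> nat" where
  "mrank M X = Max (card ` {I \<in> indep M. I \<subseteq> X})"

definition mcl :: "'a matroid_data \<Rightarrow> 'a set \<Rightarrow> 'a set" where
  "mcl M X = {e \<in> ground M. mrank M (insert e X) = mrank M X}"

definition spanning :: "'a matroid_data \<Rightarrow> 'a set \<Rightarrow> bool" where
  "spanning M S \<longleftrightarrow> S \<subseteq> ground M \<and> mcl M S = ground M"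

definition flats :: "'a matroid_data \<Rightarrow> 'a set set" where
  "flats M = {F. F \<subseteq> ground M \<and> mcl M F = F}"

definition circuit :: "'a matroid_data \<Rightarrow> 'a set \<Rightarrow> bool" where
  "circuit M C \<longleftrightarrow> C \<subseteq> ground M \<and> C \<notin> indep M \<and> (\<forall>X. X \<subset> C \<longrightarrow> X \<in> indep M)"

definition connected_matroid :: "'a matroid_data \<Rightarrow> bool" where
  "connected_matroid M \<longleftrightarrow>
     (\<forall>e\<in>ground M. \<forall>f\<in>ground M. e \<noteq> f \<longrightarrow> (\<exists>C. circuit M C \<and> e \<in> C \<and> f \<in> C))"

definition contraction :: "'a matroid_data \<Rightarrow> 'a set \<Rightarrow> 'a matroid_data" where
  "contraction M F =
     \<lparr>ground = ground M - F,
      indep = {I. I \<subseteq> ground M - F \<and> (\<exists>B. basis_in M F B \<and> I \<union> B \<in> indep M)}\<rparr>"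

definition uniform_matroid :: "nat \<Rightarrow> nat \<Rightarrow> nat matroid_data" where
  "uniform_matroid r n = \<lparr>ground = {..<n}, indep = {I. I \<subseteq> {..<n} \<and> card I \<le> r}\<rparr>"


section \<open>Tutte constellations\<close>

definition modular_cut :: "'a matroid_data \<Rightarrow> 'a set set \<Rightarrow> bool" where
  "modular_cut M \<Gamma> \<longleftrightarrow>
     \<Gamma> \<subseteq> flats M \<and>
     (\<forall>F\<in>\<Gamma>. \<forall>G\<in>flats M. F \<subseteq> G \<longrightarrow> G \<in> \<Gamma>) \<and>
     (\<forall>F\<in>\<Gamma>. \<forall>G\<in>\<Gamma>.
        mrank M F + mrank M G = mrank M (F \<inter> G) + mrank M (mcl M (F \<union> G)) \<longrightarrow> F \<inter> G \<in> \<Gamma>)"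

text \<open>A geometric lattice is presented as the lattice of flats of its simple matroid \<open>M\<close>,
  with inclusion as the order, so a constellation \<open>(\<Lambda>, \<Gamma>)\<close> is carried along with \<open>M\<close>.\<close>

type_synonym 'a constellation = "'a set set \<times> 'a set set"

definition tutte_constellation :: "'a matroid_data \<Rightarrow> 'a constellation \<Rightarrow> bool" where
  "tutte_constellation M \<tau> \<longleftrightarrow>
     simple_matroid M \<and> fst \<tau> = flats M \<and> modular_cut M (snd \<tau>)"

definition indecomposable :: "'a matroid_data \<Rightarrow> 'a constellation \<Rightarrow> bool" where
  "indecomposable M \<tau> \<longleftrightarrow> tutte_constellation M \<tau> \<and> connected_matroid M"

definition indecomposable_flat :: "'a matroid_data \<Rightarrow> 'a set \<Rightarrow> bool" where
  "indecomposable_flat M F \<longleftrightarrow> F \<in> flats M \<and> connected_matroid (contraction M F)"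

definition upper_sublattice :: "'a matroid_data \<Rightarrow> 'a set set \<Rightarrow> bool" where
  "upper_sublattice M L \<longleftrightarrow>
     (\<exists>I J. I \<subseteq> ground M \<and> J \<subseteq> ground M \<and> I \<inter> J = {} \<and>
            I \<in> indep M \<and> spanning M (ground M - J) \<and>
            L = {mcl M S | S. I \<subseteq> S \<and> S \<subseteq> ground M - J})"

definition subconstellation :: "'a matroid_data \<Rightarrow> 'a constellation \<Rightarrow> 'a constellation \<Rightarrow> bool" where
  "subconstellation M \<tau> \<sigma> \<longleftrightarrow>
     upper_sublattice M (fst \<sigma>) \<and> snd \<sigma> = snd \<tau> \<inter> fst \<sigma>"

definition subconstellation_le :: "'a constellation \<Rightarrow> 'a constellation \<Rightarrow> bool" where
  "subconstellation_le \<sigma> \<sigma>' \<longleftrightarrow> fst \<sigma> \<subseteq> fst \<sigma>'"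

text \<open>The simple matroid \<open>N\<close> represents the type of a constellation with lattice \<open>L\<close>
  when \<open>L\<close>, ordered by inclusion, is isomorphic to the lattice of flats of \<open>N\<close>.\<close>

definition has_type :: "'a constellation \<Rightarrow> 'b matroid_data \<Rightarrow> bool" where
  "has_type \<sigma> N \<longleftrightarrow>
     simple_matroid N \<and>
     (\<exists>\<phi>. bij_betw \<phi> (fst \<sigma>) (flats N) \<and>
          (\<forall>F\<in>fst \<sigma>. \<forall>G\<in>fst \<sigma>. F \<subseteq> G \<longleftrightarrow> \<phi> F \<subseteq> \<phi> G))"

definition class0 :: "'a matroid_data \<Rightarrow> 'a constellation \<Rightarrow> 'a constellation \<Rightarrow> bool" where
  "class0 M \<tau> \<sigma> \<longleftrightarrow>
     subconstellation M \<tau> \<sigma> \<and> has_type \<sigma> (uniform_matroid 1 1) \<and> snd \<sigma> = {ground M}"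

definition class1 :: "'a matroid_data \<Rightarrow> 'a constellation \<Rightarrow> 'a constellation \<Rightarrow> bool" where
  "class1 M \<tau> \<sigma> \<longleftrightarrow>
     subconstellation M \<tau> \<sigma> \<and> has_type \<sigma> (uniform_matroid 2 2) \<and> snd \<sigma> = {ground M} \<and>
     (\<exists>L\<in>fst \<sigma>. (\<forall>F\<in>fst \<sigma>. L \<subseteq> F) \<and> indecomposable_flat M L)"

definition X1 :: "'a matroid_data \<Rightarrow> 'a constellation \<Rightarrow> 'a constellation set" where
  "X1 M \<tau> = {\<sigma>. class0 M \<tau> \<sigma> \<or> class1 M \<tau> \<sigma>}"


section \<open>Order complexes and geometric realization\<close>

definition order_complex :: "'v set \<Rightarrow> ('v \<Rightarrow> 'v \<Rightarrow> bool) \<Rightarrow> 'v set set" where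
  "order_complex X r = {C. finite C \<and> C \<subseteq> X \<and> Complete_Partial_Order.chain r C}"

text \<open>Points are written in barycentric coordinates, extended by zero off the face.
  In particular, an empty face contributes no point.\<close>

definition closed_simplex :: "'v set \<Rightarrow> ('v \<Rightarrow> real) set" where
  "closed_simplex C = {t. (\<forall>v. 0 \<le> t v) \<and> (\<forall>v. v \<notin> C \<longrightarrow> t v = 0) \<and> sum t C = 1}"

text \<open>The weak topology: a set is open iff its trace on every closed simplex is.\<close>

definition geometric_realization :: "'v set set \<Rightarrow> ('v \<Rightarrow> real) topology" where
  "geometric_realization K =
     topology (\<lambda>U. U \<subseteq> (\<Union>C\<in>K. closed_simplex C) \<and>
       (\<forall>C\<in>K. openin (subtopology (powertop_real UNIV) (closed_simplex C)) (U \<inter> closed_simplex C)))"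

lemma openin_geometric_realization:
  "openin (geometric_realization K) U \<longleftrightarrow>
     U \<subseteq> (\<Union>C\<in>K. closed_simplex C) \<and>
     (\<forall>C\<in>K. openin (subtopology (powertop_real UNIV) (closed_simplex C)) (U \<inter> closed_simplex C))"
proof -
  let ?P = "\<lambda>U. U \<subseteq> (\<Union>C\<in>K. closed_simplex C) \<and>
     (\<forall>C\<in>K. openin (subtopology (powertop_real UNIV) (closed_simplex C)) (U \<inter> closed_simplex C))"
  have "istopology ?P"
    unfolding istopology_def
  proof (intro conjI allI impI)
    fix S T
    assume S: "?P S" and T: "?P T"
    have eq: "S \<inter> T \<inter> closed_simplex C = (S \<inter> closed_simplex C) \<inter> (T \<inter> closed_simplex C)" for C
      by blast
    show "S \<inter> T \<subseteq> (\<Union>C\<in>K. closed_simplex C)"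
      using S by blast
    show "\<forall>C\<in>K. openin (subtopology (powertop_real UNIV) (closed_simplex C)) (S \<inter> T \<inter> closed_simplex C)"
      unfolding eq using S T by (blast intro: openin_Int)
  next
    fix \<K>
    assume K: "\<forall>S\<in>\<K>. ?P S"
    have eq: "\<Union>\<K> \<inter> closed_simplex C = (\<Union>S\<in>\<K>. S \<inter> closed_simplex C)" for C
      by blast
    show "\<Union>\<K> \<subseteq> (\<Union>C\<in>K. closed_simplex C)"
      using K by blast
    show "\<forall>C\<in>K. openin (subtopology (powertop_real UNIV) (closed_simplex C)) (\<Union>\<K> \<inter> closed_simplex C)"
      unfolding eq using K by (blast intro: openin_Union)
  qed
  then show ?thesis
    by (simp add: geometric_realization_def)
qed

definition Sigma1 :: "'a matroid_data \<Rightarrow> 'a constellation \<Rightarrow> 'a constellation set set" where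
  "Sigma1 M \<tau> = order_complex (X1 M \<tau>) subconstellation_le"

end

theory Submission
  imports Defs
begin

text \<open>
  The class 0 elements are the hyperplanes off \<open>\<Gamma>\<close>, and each class 1 element lies above exactly
  two of them, so the claim amounts to Tutte's path theorem: any two hyperplanes \<open>X, Y \<notin> \<Gamma>\<close> are
  joined by a path of hyperplanes off \<open>\<Gamma>\<close> in which consecutive ones meet in an indecomposable flat
  of corank 2. By induction on the corank of an indecomposable flat \<open>F \<subseteq> X \<inter> Y\<close>: if the corank is at
  least 3, then \<open>X\<close> and \<open>Y\<close> contain indecomposable covers \<open>P\<close> and \<open>Q\<close> of \<open>F\<close>. If \<open>P \<or> Q \<notin> \<Gamma>\<close>,
  pass through a hyperplane off \<open>\<Gamma>\<close> above \<open>P \<or> Q\<close>. Otherwise there is an indecomposable cover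
  \<open>S\<close> of \<open>F\<close> outside \<open>P \<or> Q\<close>, since the indecomposable covers of \<open>F\<close> lie in no proper flat;
  modularity of \<open>\<Gamma>\<close> gives \<open>P \<or> S, Q \<or> S \<notin> \<Gamma>\<close>, and one detours via \<open>S\<close>.
\<close>

section \<open>Rank and closure\<close>

locale finite_matroid =
  fixes M :: "'a matroid_data"
  assumes matroid: "matroid M"
begin

abbreviation E where "E \<equiv> ground M"
abbreviation r where "r \<equiv> mrank M"
abbreviation cl where "cl \<equiv> mcl M"

lemma finite_ground: "finite E"
  using matroid by (simp add: matroid_def)

lemma indep_ground: "I \<in> indep M \<Longrightarrow> I \<subseteq> E"
  using matroid by (auto simp: matroid_def)

lemma finite_indep: "I \<in> indep M \<Longrightarrow> finite I"
  using indep_ground finite_ground finite_subset by blast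

lemma indep_empty: "{} \<in> indep M"
  using matroid by (simp add: matroid_def)

lemma indep_subset: "I \<in> indep M \<Longrightarrow> J \<subseteq> I \<Longrightarrow> J \<in> indep M"
  using matroid unfolding matroid_def by blast

lemma indep_exchange:
  assumes "I \<in> indep M" "J \<in> indep M" "card I < card J"
  obtains e where "e \<in> J - I" "insert e I \<in> indep M"
  using matroid assms unfolding matroid_def by blast

lemma finite_indep_sets: "finite (indep M)"
proof (rule finite_subset)
  show "indep M \<subseteq> Pow E" using indep_ground by blast
qed (simp add: finite_ground)

lemma card_le_rank: "I \<in> indep M \<Longrightarrow> I \<subseteq> X \<Longrightarrow> card I \<le> r X"
  unfolding mrank_def by (rule Max_ge) (auto simp: finite_indep_sets)

lemma rank_attained:
  obtains I where "I \<in> indep M" "I \<subseteq> X" "card I = r X"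
proof -
  have "r X \<in> card ` {I \<in> indep M. I \<subseteq> X}"
    unfolding mrank_def by (rule Max_in) (use finite_indep_sets indep_empty in auto)
  then show thesis using that by auto
qed

lemma rank_mono: "X \<subseteq> Y \<Longrightarrow> r X \<le> r Y"
  by (metis rank_attained card_le_rank subset_trans)

lemma rank_insert_ge: "r X \<le> r (insert e X)"
  by (rule rank_mono) blast

lemma rank_le_card: "finite X \<Longrightarrow> r X \<le> card X"
  by (metis rank_attained card_mono)

lemma rank_indep: "I \<in> indep M \<Longrightarrow> r I = card I"
  by (simp add: card_le_rank finite_indep le_antisym rank_le_card)

lemma indep_iff_rank: "X \<subseteq> E \<Longrightarrow> X \<in> indep M \<longleftrightarrow> r X = card X"
  by (metis rank_attained card_subset_eq finite_ground finite_subset rank_indep)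

lemma indep_extend:
  assumes "I \<in> indep M" "I \<subseteq> X"
  obtains B where "B \<in> indep M" "I \<subseteq> B" "B \<subseteq> X" "card B = r X"
proof -
  let ?S = "{B \<in> indep M. I \<subseteq> B \<and> B \<subseteq> X}"
  have "finite ?S" "?S \<noteq> {}" using finite_indep_sets assms by auto
  then have "Max (card ` ?S) \<in> card ` ?S" by (intro Max_in) auto
  then obtain B where B: "B \<in> ?S" and "card B = Max (card ` ?S)" by (metis (no_types, lifting) imageE)
  then have max: "\<forall>C\<in>?S. card C \<le> card B" using \<open>finite ?S\<close> by simp
  have "\<not> card B < r X"
  proof
    assume less: "card B < r X"
    obtain J where J: "J \<in> indep M" "J \<subseteq> X" "card J = r X" by (rule rank_attained)
    obtain e where e: "e \<in> J - B" "insert e B \<in> indep M"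
      using indep_exchange[of B J] B J less by auto
    then have "insert e B \<in> ?S" using B J by auto
    then have "card (insert e B) \<le> card B" using max by blast
    moreover have "finite B" using B finite_indep by blast
    ultimately show False using e by auto
  qed
  moreover have "card B \<le> r X" using B card_le_rank by auto
  ultimately show thesis using that B by auto
qed

text \<open>A basis \<open>I\<close> of the intersection extends to a basis \<open>J\<close> of the
  union. The traces of \<open>J\<close> on \<open>X\<close> and \<open>Y\<close> are independent, so
  counting \<open>J\<close> by inclusion-exclusion gives the inequality.\<close>

lemma rank_submodular: "r (X \<union> Y) + r (X \<inter> Y) \<le> r X + r Y"
proof -
  obtain I where I: "I \<in> indep M" "I \<subseteq> X \<inter> Y" "card I = r (X \<inter> Y)" by (rule rank_attained)
  then obtain J where J: "J \<in> indep M" "I \<subseteq> J" "J \<subseteq> X \<union> Y" "card J = r (X \<union> Y)"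
    using indep_extend[of I "X \<union> Y"] by auto
  have fin: "finite J" using J finite_indep by blast
  have "card I \<le> card (J \<inter> X \<inter> Y)"
    by (rule card_mono) (use fin I J in auto)
  moreover have "card (J \<inter> X) + card (J \<inter> Y) = card J + card (J \<inter> X \<inter> Y)"
  proof -
    have "(J \<inter> X) \<union> (J \<inter> Y) = J" "(J \<inter> X) \<inter> (J \<inter> Y) = J \<inter> X \<inter> Y" using J by auto
    then show ?thesis using card_Un_Int[of "J \<inter> X" "J \<inter> Y"] fin by simp
  qed
  moreover have "card (J \<inter> X) \<le> r X" "card (J \<inter> Y) \<le> r Y"
    using J by (auto intro!: card_le_rank intro: indep_subset)
  ultimately show ?thesis using I J by linarith
qed

lemma rank_empty: "r {} = 0"
  using rank_indep[OF indep_empty] by simp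

lemma rank_insert_le: "r (insert e X) \<le> Suc (r X)"
proof -
  have "r {e} \<le> 1" using rank_le_card[of "{e}"] by simp
  then show ?thesis using rank_submodular[of "{e}" X] by simp
qed

section \<open>Closure and flats\<close>

lemma cl_ground: "cl X \<subseteq> E"
  by (auto simp: mcl_def)

lemma subset_cl: "X \<subseteq> E \<Longrightarrow> X \<subseteq> cl X"
  by (auto simp: mcl_def insert_absorb)

text \<open>Submodularity makes rank gains diminishing: adjoining \<open>e\<close> raises the rank
  of the larger set by no more than that of the smaller one.\<close>

lemma cl_mono: "X \<subseteq> Y \<Longrightarrow> cl X \<subseteq> cl Y"
proof
  fix e assume XY: "X \<subseteq> Y" and e: "e \<in> cl X"
  have "r (insert e Y) + r X \<le> r (insert e X \<union> Y) + r (insert e X \<inter> Y)"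
    by (intro add_mono rank_mono) (use XY in auto)
  also have "\<dots> \<le> r (insert e X) + r Y" by (rule rank_submodular)
  finally have "r (insert e Y) \<le> r Y" using e by (simp add: mcl_def)
  then show "e \<in> cl Y" using e rank_insert_ge[of Y e] by (simp add: mcl_def)
qed

lemma rank_cl: "X \<subseteq> E \<Longrightarrow> r (cl X) = r X"
proof -
  assume X: "X \<subseteq> E"
  \<comment> \<open>Elements of the closure are adjoined one at a time; by monotonicity each still
    lies in the closure of the set built so far, so the rank never grows.\<close>
  have "r (X \<union> Y) = r X" if "finite Y" "Y \<subseteq> cl X" for Y
    using that
  proof (induction Y)
    case (insert e Y)
    have "e \<in> cl (X \<union> Y)" using insert.prems cl_mono[of X "X \<union> Y"] by auto
    then show ?case using insert by (simp add: mcl_def)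
  qed simp
  from this[of "cl X"] show ?thesis
    using X finite_ground cl_ground finite_subset subset_cl by (metis Un_absorb1 subset_refl)
qed

lemma cl_cl: "X \<subseteq> E \<Longrightarrow> cl (cl X) = cl X"
proof
  assume X: "X \<subseteq> E"
  show "cl (cl X) \<subseteq> cl X"
  proof
    fix e assume e: "e \<in> cl (cl X)"
    have "r (insert e X) \<le> r (insert e (cl X))"
      by (rule rank_mono) (use subset_cl[OF X] in auto)
    also have "\<dots> = r (cl X)" using e by (simp add: mcl_def[of M "cl X"])
    also have "\<dots> = r X" by (rule rank_cl[OF X])
    finally show "e \<in> cl X"
      using e rank_insert_ge[of X e] cl_ground by (auto simp: mcl_def[of M X])
  qed
  show "cl X \<subseteq> cl (cl X)" using subset_cl cl_ground by blast
qed

lemma flatsD: "F \<in> flats M \<Longrightarrow> F \<subseteq> E" "F \<in> flats M \<Longrightarrow> cl F = F"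
  by (auto simp: flats_def)

lemma cl_flat: "X \<subseteq> E \<Longrightarrow> cl X \<in> flats M"
  by (simp add: flats_def cl_ground cl_cl)

lemma ground_flat: "E \<in> flats M"
  using subset_cl cl_ground by (auto simp: flats_def)

lemma cl_least: "F \<in> flats M \<Longrightarrow> X \<subseteq> F \<Longrightarrow> cl X \<subseteq> F"
  using cl_mono flatsD by metis

lemma flat_Int: "F \<in> flats M \<Longrightarrow> G \<in> flats M \<Longrightarrow> F \<inter> G \<in> flats M"
  unfolding flats_def using cl_mono[of "F \<inter> G" F] cl_mono[of "F \<inter> G" G] subset_cl[of "F \<inter> G"]
  by auto

lemma flat_rank_eq: "F \<in> flats M \<Longrightarrow> G \<in> flats M \<Longrightarrow> F \<subseteq> G \<Longrightarrow> r G \<le> r F \<Longrightarrow> F = G"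
proof
  assume *: "F \<in> flats M" "G \<in> flats M" "F \<subseteq> G" "r G \<le> r F"
  show "G \<subseteq> F"
  proof
    fix e assume e: "e \<in> G"
    have "r (insert e F) \<le> r G" by (rule rank_mono) (use * e in auto)
    then have "r (insert e F) = r F" using * rank_insert_ge[of F e] by linarith
    then have "e \<in> cl F" using * e flatsD(1)[of G] by (auto simp: mcl_def)
    then show "e \<in> F" using * flatsD by blast
  qed
qed

lemma flat_rank_less: "F \<in> flats M \<Longrightarrow> G \<in> flats M \<Longrightarrow> F \<subset> G \<Longrightarrow> r F < r G"
  using flat_rank_eq[of F G] by (metis leI psubsetE subset_refl)

lemma rank_join_le: "A \<subseteq> E \<Longrightarrow> B \<subseteq> E \<Longrightarrow> r (cl (A \<union> B)) + r (A \<inter> B) \<le> r A + r B"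
  using rank_submodular rank_cl by simp

text \<open>The covering relation of the lattice of flats, expressed through the grading by rank.
  Covers of \<open>F\<close> are the points of the contraction by \<open>F\<close>, and
  \<open>covers H E\<close> says that \<open>H\<close> is a hyperplane.\<close>

definition covers :: "'a set \<Rightarrow> 'a set \<Rightarrow> bool" where
  "covers F P \<longleftrightarrow> F \<in> flats M \<and> P \<in> flats M \<and> F \<subseteq> P \<and> r P = Suc (r F)"

lemma coversD:
  assumes "covers F P"
  shows "F \<in> flats M" "P \<in> flats M" "F \<subseteq> P" "r P = Suc (r F)" "F \<noteq> P"
  using assms by (auto simp: covers_def)

lemma covers_cl_insert:
  assumes "F \<in> flats M" "e \<in> E" "e \<notin> F"
  shows "covers F (cl (insert e F))"
proof -
  have sub: "insert e F \<subseteq> E" using assms flatsD by blast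
  then have "F \<subseteq> cl (insert e F)" "e \<in> cl (insert e F)" using subset_cl by blast+
  moreover have "r (cl (insert e F)) \<le> Suc (r F)" using sub rank_cl rank_insert_le by simp
  moreover have "cl (insert e F) \<in> flats M" using sub cl_flat by simp
  ultimately show ?thesis
    using assms flat_rank_less[of F "cl (insert e F)"] by (force simp: covers_def)
qed

lemma covers_eq_cl: "covers F P \<Longrightarrow> e \<in> P \<Longrightarrow> e \<notin> F \<Longrightarrow> P = cl (insert e F)"
proof -
  assume *: "covers F P" "e \<in> P" "e \<notin> F"
  then have c: "covers F (cl (insert e F))"
    by (intro covers_cl_insert) (use flatsD(1)[of P] in \<open>auto simp: covers_def\<close>)
  have "cl (insert e F) \<subseteq> P" using * coversD[of F P] by (intro cl_least) auto
  then show ?thesis using flat_rank_eq[of "cl (insert e F)" P] c * by (auto simp: covers_def)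
qed

lemma covers_between:
  assumes "covers F P" "G \<in> flats M" "F \<subseteq> G" "G \<subseteq> P"
  shows "G = F \<or> G = P"
  using assms flat_rank_less[of F G] flat_rank_less[of G P] by (fastforce simp: covers_def)

lemma covers_Int_subset:
  assumes "covers F P" "G \<in> flats M" "F \<subseteq> G" "\<not> P \<subseteq> G"
  shows "P \<inter> G = F"
  using covers_between[OF assms(1), of "P \<inter> G"] assms flat_Int[of P G] coversD[OF assms(1)] by auto

lemma covers_subset_eq: "covers F P \<Longrightarrow> covers F Q \<Longrightarrow> P \<subseteq> Q \<Longrightarrow> P = Q"
  using flat_rank_eq[of P Q] by (auto simp: covers_def)

text \<open>One element of \<open>G\<close> outside \<open>H\<close>, added to \<open>F\<close>,
  generates the cover. The flat \<open>H\<close> steers the cover away from a prescribed region;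
  \<open>H = F\<close> asks merely for some cover below \<open>G\<close>.\<close>

lemma covers_exists:
  assumes "F \<in> flats M" "G \<in> flats M" "H \<in> flats M" "F \<subseteq> H" "\<not> G \<subseteq> H" "F \<subseteq> G"
  obtains P where "covers F P" "P \<subseteq> G" "\<not> P \<subseteq> H"
proof -
  obtain e where e: "e \<in> G" "e \<notin> H" using assms by blast
  have "insert e F \<subseteq> E" using e assms flatsD by blast
  then have "e \<in> cl (insert e F)" using subset_cl by blast
  moreover have "cl (insert e F) \<subseteq> G" by (rule cl_least) (use e assms in auto)
  moreover have "covers F (cl (insert e F))" using covers_cl_insert e assms flatsD by blast
  ultimately show thesis using that e by blast
qed

text \<open>Semimodularity of the lattice: distinct covers meet in \<open>F\<close>, so
  submodularity lets the join exceed \<open>P\<close> by at most one rank.\<close>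

lemma covers_join:
  assumes "covers F P" "covers F Q" "P \<noteq> Q"
  shows "covers P (cl (P \<union> Q))"
proof -
  have sub: "P \<union> Q \<subseteq> E" using assms by (simp add: covers_def flatsD)
  then have J: "cl (P \<union> Q) \<in> flats M" "P \<subseteq> cl (P \<union> Q)" "Q \<subseteq> cl (P \<union> Q)"
    using cl_flat subset_cl by blast+
  have "\<not> Q \<subseteq> P" using assms covers_subset_eq by blast
  then have "Q \<inter> P = F" using covers_Int_subset[OF assms(2), of P] coversD[OF assms(1)] by blast
  then have "r (cl (P \<union> Q)) \<le> Suc (r P)"
    using rank_join_le[of P Q] sub assms by (simp add: covers_def Int_commute)
  moreover have "r P < r (cl (P \<union> Q))"
    using flat_rank_less[of P "cl (P \<union> Q)"] J \<open>\<not> Q \<subseteq> P\<close> coversD[OF assms(1)] by blast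
  ultimately show ?thesis using J coversD[OF assms(1)] by (simp add: covers_def)
qed

section \<open>Separations of intervals of flats\<close>

text \<open>For flats \<open>F \<subseteq> G\<close>, a separation of the minor \<open>(M | G) / F\<close> into \<open>A - F\<close> and \<open>B - F\<close>;
  both \<open>A\<close> and \<open>B\<close> are then automatically flats of \<open>M\<close>, so no minors have to be formed.\<close>

definition separation :: "'a set \<Rightarrow> 'a set \<Rightarrow> 'a set \<Rightarrow> 'a set \<Rightarrow> bool" where
  "separation F G A B \<longleftrightarrow> {F, G, A, B} \<subseteq> flats M \<and> A \<union> B = G \<and> A \<inter> B = F \<and>
     A \<noteq> F \<and> B \<noteq> F \<and> r A + r B = r G + r F"

definition conn :: "'a set \<Rightarrow> 'a set \<Rightarrow> bool" where
  "conn F G \<longleftrightarrow> F \<in> flats M \<and> G \<in> flats M \<and> F \<subseteq> G \<and> (\<nexists>A B. separation F G A B)"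

lemma separation_sym: "separation F G A B \<Longrightarrow> separation F G B A"
  by (auto simp: separation_def)

lemma separationD:
  assumes "separation F G A B"
  shows "F \<in> flats M" "G \<in> flats M" "A \<in> flats M" "B \<in> flats M" "A \<union> B = G" "A \<inter> B = F"
    "A \<noteq> F" "B \<noteq> F" "r A + r B = r G + r F" "F \<subseteq> A" "F \<subseteq> B" "A \<subseteq> G" "B \<subseteq> G" "F \<subseteq> G"
  using assms by (auto simp: separation_def)

lemma separation_rank_less: "separation F G A B \<Longrightarrow> r F < r A \<and> r A < r G"
proof -
  assume s: "separation F G A B"
  note sD = separationD[OF s]
  have "r F < r A" by (rule flat_rank_less) (use sD in blast)+
  moreover have "r F < r B" by (rule flat_rank_less) (use sD in blast)+
  ultimately show ?thesis using sD(9) by linarith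
qed

text \<open>The rank of a direct sum is additive over its summands, for any intermediate set and not
  just for flats. Submodularity against \<open>B\<close> and then against \<open>A\<close> gives one
  inequality, submodularity of the two traces the other.\<close>

lemma separation_restrict:
  assumes s: "separation F G A B" and X: "F \<subseteq> X" "X \<subseteq> G"
  shows "r (X \<inter> A) + r (X \<inter> B) = r X + r F"
proof -
  note sD = separationD[OF s]
  have "r (X \<union> B) + r (X \<inter> B) \<le> r X + r B" by (rule rank_submodular)
  moreover have "r G + r (X \<inter> A) \<le> r ((X \<union> B) \<union> A) + r ((X \<union> B) \<inter> A)"
    by (intro add_mono rank_mono) (use X sD(5) in auto)
  moreover have "r ((X \<union> B) \<union> A) + r ((X \<union> B) \<inter> A) \<le> r (X \<union> B) + r A" by (rule rank_submodular)
  moreover have "r ((X \<inter> A) \<union> (X \<inter> B)) + r ((X \<inter> A) \<inter> (X \<inter> B)) \<le> r (X \<inter> A) + r (X \<inter> B)"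
    by (rule rank_submodular)
  moreover have "(X \<inter> A) \<union> (X \<inter> B) = X" "(X \<inter> A) \<inter> (X \<inter> B) = F" using X sD(5,6) by auto
  ultimately show ?thesis using sD(9) by simp
qed

text \<open>If contracting \<open>P\<close> disconnects, the interval is a parallel connection with base point \<open>P\<close>;
  the parts inherit connectedness, and contractions of a part away from \<open>P\<close> lift.\<close>

lemma conn_part:
  assumes c: "conn F G" and P: "covers F P" and s: "separation P G A B"
  shows "conn F A"
proof -
  note sD = separationD[OF s] and pD = coversD[OF P]
  \<comment> \<open>If the side \<open>C\<close> contains \<open>P\<close>, it can absorb
    \<open>B\<close>: the pair \<open>D\<close>, \<open>cl (C \<union> B)\<close> would separate all
    of \<open>G\<close> over \<open>F\<close>.\<close>
  have False if t: "separation F A C D" and PC: "P \<subseteq> C" for C D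
  proof -
    note tD = separationD[OF t]
    let ?K = "cl (C \<union> B)"
    have CB: "C \<union> B \<subseteq> E" using tD(3) sD(4) by (simp add: flatsD)
    have K: "?K \<in> flats M" "C \<subseteq> ?K" "B \<subseteq> ?K" using cl_flat[OF CB] subset_cl[OF CB] by auto
    have KG: "?K \<subseteq> G" by (rule cl_least) (use tD(12) sD in auto)
    have "C \<inter> B = P" using PC tD(12) sD(6) by blast
    then have "r ?K + r P \<le> r C + r B" using rank_join_le[of C B] CB by simp
    then have 1: "r ?K + r D \<le> r G + r F" using tD sD by linarith
    have DK: "D \<union> ?K = G" using KG K(2,3) tD(5) sD(5) by blast
    have 2: "r G + r (D \<inter> ?K) \<le> r D + r ?K"
      using rank_submodular[of D ?K] DK by simp
    have "F \<subseteq> D \<inter> ?K" using tD(10,11) K(2) by blast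
    then have DKF: "D \<inter> ?K = F"
      using flat_rank_eq[of F "D \<inter> ?K"] flat_Int[of D ?K] K(1) tD(1,4) 1 2 by simp
    have "?K \<noteq> F" using K(3) sD(11) pD(3,5) by blast
    moreover have "r D + r ?K = r G + r F" using 1 2 DKF by simp
    ultimately have "separation F G D ?K"
      using tD(1,4,8) sD(2) K(1) DK DKF by (simp add: separation_def)
    then show False using c by (auto simp: conn_def)
  qed
  \<comment> \<open>A cover is generated over \<open>F\<close> by a single element, hence lies
    entirely on one side; by symmetry that side may be called \<open>C\<close>.\<close>
  moreover have "P \<subseteq> C \<or> P \<subseteq> D" if t: "separation F A C D" for C D
  proof -
    note tD = separationD[OF t]
    obtain e where e: "e \<in> P" "e \<notin> F" using pD(3,5) by blast
    then have "P = cl (insert e F)" using covers_eq_cl P by blast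
    moreover have "e \<in> C \<or> e \<in> D" using e tD(5) sD(10) by blast
    ultimately show ?thesis using cl_least[of C "insert e F"] cl_least[of D "insert e F"] tD(3,4,10,11)
      by auto
  qed
  ultimately have "\<nexists>C D. separation F A C D" using separation_sym by blast
  then show ?thesis using sD(3,10) pD(1,3) by (auto simp: conn_def)
qed

lemma conn_lift:
  assumes P: "covers F P" and s: "separation P G A B" and Q: "covers F Q" "Q \<subseteq> A" "Q \<noteq> P"
    and cA: "conn Q A" and cB: "conn F B"
  shows "conn Q G"
proof -
  note sD = separationD[OF s] and pD = coversD[OF P] and qD = coversD[OF Q(1)]
  have nQP: "\<not> Q \<subseteq> P" using covers_subset_eq P Q by blast
  then have QP: "Q \<inter> P = F" using covers_Int_subset[OF Q(1)] pD by blast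
  \<comment> \<open>If \<open>D\<close> meets \<open>A\<close> only in \<open>Q\<close>, then
    \<open>C\<close> contains \<open>A\<close>, and the traces of \<open>C\<close> and
    \<open>D\<close> on \<open>B\<close> separate \<open>B\<close> over \<open>F\<close>.\<close>
  have False if t: "separation Q G C D" and DA: "D \<inter> A = Q" for C D
  proof -
    note tD = separationD[OF t]
    have AC: "A \<subseteq> C" using tD(5,10) DA sD(12) by blast
    have PC: "P \<subseteq> C \<inter> B" using sD(10,11) AC by blast
    have CDB: "(C \<inter> B) \<inter> (D \<inter> B) = F" using tD(6) sD(6) QP Q(2) by blast
    have CDU: "(C \<inter> B) \<union> (D \<inter> B) = B" using tD(5) sD(13) by blast
    have fl: "C \<inter> B \<in> flats M" "D \<inter> B \<in> flats M" using flat_Int tD(3,4) sD(4) by auto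
    have DBF: "D \<inter> B \<noteq> F"
    proof
      assume "D \<inter> B = F"
      then have "D \<subseteq> Q" using tD(13) sD(5) DA qD(3) by blast
      then show False using tD(8,11) by blast
    qed
    have "r (C \<inter> A) + r (C \<inter> B) = r C + r P"
      using separation_restrict[OF s, of C] PC tD(12) by blast
    moreover have "C \<inter> A = A" using AC by blast
    ultimately have 1: "r A + r (C \<inter> B) = r C + r P" by simp
    \<comment> \<open>\<open>D\<close> contains \<open>Q\<close>, which does not lie in
      \<open>B\<close>. The rank lost by passing to \<open>D \<inter> B\<close> makes up for
      \<open>r Q\<close> exceeding \<open>r F\<close> by one.\<close>
    have "D \<inter> B \<subset> D"
    proof -
      have "\<not> Q \<subseteq> B" using QP sD(6) Q(2) qD(3,5) by blast
      then show ?thesis using tD(11) by blast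
    qed
    then have 2: "r (D \<inter> B) < r D" by (intro flat_rank_less fl tD(4))
    have 3: "r B + r F \<le> r (C \<inter> B) + r (D \<inter> B)"
      using rank_submodular[of "C \<inter> B" "D \<inter> B"] CDU CDB by simp
    have "r (C \<inter> B) + r (D \<inter> B) = r B + r F"
      using 1 2 3 sD(9) tD(9) pD(4) qD(4) by linarith
    then have "separation F B (C \<inter> B) (D \<inter> B)"
      using fl CDB CDU DBF PC pD(1,3,5) sD(4) unfolding separation_def by blast
    then show False using cB by (auto simp: conn_def)
  qed
  \<comment> \<open>Otherwise the traces on \<open>A\<close> would separate \<open>A\<close> over
    \<open>Q\<close>.\<close>
  moreover have "D \<inter> A = Q \<or> C \<inter> A = Q" if t: "separation Q G C D" for C D
  proof (rule ccontr)
    assume n: "\<not> ?thesis"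
    note tD = separationD[OF t]
    have "r (A \<inter> C) + r (A \<inter> D) = r A + r Q"
      using separation_restrict[OF t, of A] Q(2) sD(12) by blast
    moreover have "(C \<inter> A) \<union> (D \<inter> A) = A" "(C \<inter> A) \<inter> (D \<inter> A) = Q"
      using tD(5,6) sD(12) Q(2) by blast+
    ultimately have "separation Q A (C \<inter> A) (D \<inter> A)"
      using n flat_Int tD(3,4) sD(3) qD(2) by (simp add: separation_def Int_commute)
    then show False using cA by (auto simp: conn_def)
  qed
  ultimately have "\<nexists>C D. separation Q G C D" using separation_sym by blast
  then show ?thesis using sD(2,12) qD(2) Q(2) by (auto simp: conn_def)
qed

text \<open>Induction on the rank of the interval. If some cover \<open>P\<close> outside
  \<open>H\<close> disconnects, both parts of the resulting separation contain \<open>P\<close>, so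
  neither lies in \<open>H\<close>, and each supplies a cover that lifts to \<open>G\<close>. Asking
  for two covers is what makes the induction work: one of the two found in a part may be
  \<open>P\<close> itself.\<close>

lemma connected_contractions_outside:
  assumes "conn F G" "r F + 2 \<le> r G" "H \<in> flats M" "F \<subseteq> H" "\<not> G \<subseteq> H"
  shows "\<exists>P Q. P \<noteq> Q \<and> (\<forall>X\<in>{P, Q}. covers F X \<and> X \<subseteq> G \<and> \<not> X \<subseteq> H \<and> conn X G)"
  using assms
proof (induction "r G - r F" arbitrary: G H rule: less_induct)
  case less
  have F: "F \<in> flats M" and G: "G \<in> flats M" and FG: "F \<subseteq> G"
    using less.prems by (auto simp: conn_def)
  show ?case
  proof (cases "\<forall>P. covers F P \<and> P \<subseteq> G \<and> \<not> P \<subseteq> H \<longrightarrow> conn P G")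
    case True
    obtain P where P: "covers F P" "P \<subseteq> G" "\<not> P \<subseteq> H"
      using covers_exists[OF F G \<open>H \<in> flats M\<close>] less.prems FG by blast
    note pD = coversD[OF P(1)]
    \<comment> \<open>If \<open>P\<close> were the only cover outside \<open>H\<close>, every
      element of \<open>G\<close> outside \<open>H\<close> would lie in \<open>P\<close>, and
      \<open>H \<inter> G\<close> and \<open>P\<close> would separate \<open>G\<close> over
      \<open>F\<close>.\<close>
    have "\<exists>Q. covers F Q \<and> Q \<subseteq> G \<and> \<not> Q \<subseteq> H \<and> Q \<noteq> P"
    proof (rule ccontr)
      assume none: "\<nexists>Q. covers F Q \<and> Q \<subseteq> G \<and> \<not> Q \<subseteq> H \<and> Q \<noteq> P"
      let ?H = "H \<inter> G"
      have fH: "?H \<in> flats M" using flat_Int less.prems G by blast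
      have "e \<in> P" if e: "e \<in> G" "e \<notin> H" for e
      proof -
        have eE: "e \<in> E" using e G flatsD by blast
        have "insert e F \<subseteq> E" using eE F flatsD by blast
        then have e': "e \<in> cl (insert e F)" using subset_cl by blast
        have "covers F (cl (insert e F))" using covers_cl_insert F eE e less.prems by blast
        moreover have "cl (insert e F) \<subseteq> G" by (rule cl_least) (use e G FG in auto)
        ultimately have "cl (insert e F) = P" using none e e' by blast
        then show ?thesis using e' by blast
      qed
      then have U: "?H \<union> P = G" using P by blast
      have I: "?H \<inter> P = F" using covers_Int_subset[OF P(1), of ?H] fH P less.prems FG by blast
      have "?H \<noteq> F"
      proof
        assume "?H = F"
        then have "G = P" using U pD by blast
        then show False using pD less.prems by simp
      qed
      moreover have "?H \<subset> G" using less.prems by blast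
      then have "r ?H < r G" using flat_rank_less fH G by blast
      then have "r ?H + r P = r G + r F"
        using rank_submodular[of ?H P] I U pD by simp
      ultimately have "separation F G ?H P"
        using U I fH pD G unfolding separation_def by auto
      then show False using less.prems by (auto simp: conn_def)
    qed
    then obtain Q where "covers F Q" "Q \<subseteq> G" "\<not> Q \<subseteq> H" "Q \<noteq> P" by blast
    then show ?thesis using True P by (intro exI[of _ P] exI[of _ Q]) auto
  next
    case False
    then obtain P A B where P: "covers F P" "P \<subseteq> G" "\<not> P \<subseteq> H" and s: "separation P G A B"
      using G coversD unfolding conn_def by blast
    have part: "\<exists>Q. covers F Q \<and> Q \<subseteq> A \<and> Q \<noteq> P \<and> \<not> Q \<subseteq> H \<and> conn Q G"
      if s: "separation P G A B" for A B
    proof -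
      have cA: "conn F A" using conn_part less.prems P s by blast
      have cB: "conn F B" using conn_part less.prems P s separation_sym by blast
      have rk: "r F < r P" "r P < r A" "r A < r G"
        using separation_rank_less[OF s] coversD(4)[OF P(1)] by auto
      have "\<not> A \<subseteq> H" using P(3) separationD(10)[OF s] by blast
      then have "\<exists>P Q. P \<noteq> Q \<and> (\<forall>X\<in>{P, Q}. covers F X \<and> X \<subseteq> A \<and> \<not> X \<subseteq> H \<and> conn X A)"
        by (intro less.hyps cA less.prems(3,4)) (use rk in linarith)+
      then obtain Q where Q: "Q \<noteq> P" "covers F Q" "Q \<subseteq> A" "\<not> Q \<subseteq> H" "conn Q A"
        by (metis insertCI)
      then show ?thesis using conn_lift[OF P(1) s Q(2,3,1) Q(5) cB] by blast
    qed
    obtain Q where Q: "covers F Q" "Q \<subseteq> A" "Q \<noteq> P" "\<not> Q \<subseteq> H" "conn Q G" using part[OF s] by blast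
    obtain Q' where Q': "covers F Q'" "Q' \<subseteq> B" "Q' \<noteq> P" "\<not> Q' \<subseteq> H" "conn Q' G"
      using part[OF separation_sym[OF s]] by blast
    \<comment> \<open>A common cover would lie in \<open>A \<inter> B = P\<close> and so equal
      \<open>P\<close>.\<close>
    have "Q \<noteq> Q'"
      using covers_subset_eq[OF Q(1) P(1)] Q(2,3) Q'(2) separationD(6)[OF s] by blast
    then show ?thesis
      using Q Q' separationD(12,13)[OF s] by (intro exI[of _ Q] exI[of _ Q']) auto
  qed
qed

text \<open>Start with any cover \<open>P\<close> of \<open>F\<close> inside \<open>X\<close>. If it
  disconnects, one of the two parts lies in the hyperplane \<open>X\<close> of \<open>G\<close>, and
  a good cover found in that part lifts to \<open>G\<close>.\<close>

lemma connected_contraction_in_hyperplane: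
  assumes c: "conn F G" and rk: "r F + 2 \<le> r G" and X: "covers X G" "F \<subseteq> X"
  obtains P where "covers F P" "P \<subseteq> X" "conn P G"
proof -
  note result = that and xD = coversD[OF X(1)]
  have F: "F \<in> flats M" using c by (simp add: conn_def)
  have "\<not> X \<subseteq> F" using rk xD rank_mono[of X F] by auto
  then obtain P where P: "covers F P" "P \<subseteq> X" using covers_exists[OF F xD(1) F] X by blast
  show thesis
  proof (cases "conn P G")
    case False
    then obtain A B where s: "separation P G A B"
      using P xD coversD unfolding conn_def by blast
    have inside: thesis if s: "separation P G A B" and AX: "A \<subseteq> X" for A B
    proof -
      have cA: "conn F A" using conn_part c P s by blast
      have cB: "conn F B" using conn_part c P s separation_sym by blast
      have rk: "r F < r P" "r P < r A"
        using separation_rank_less[OF s] coversD(4)[OF P(1)] by auto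
      then have "\<not> A \<subseteq> F" using rank_mono[of A F] by linarith
      \<comment> \<open>Taking \<open>F\<close> as the flat to be avoided imposes no restriction on
        covers of \<open>F\<close>; of the two covers obtained, at least one differs from
        \<open>P\<close>.\<close>
      then have "\<exists>P Q. P \<noteq> Q \<and> (\<forall>X\<in>{P, Q}. covers F X \<and> X \<subseteq> A \<and> \<not> X \<subseteq> F \<and> conn X A)"
        by (intro connected_contractions_outside cA F order_refl) (use rk in linarith)+
      then obtain Q where Q: "Q \<noteq> P" "covers F Q" "Q \<subseteq> A" "conn Q A"
        by (metis insertCI)
      then show thesis
        using result[OF Q(2) _ conn_lift[OF P(1) s Q(2,3,1,4) cB]] AX by blast
    qed
    note sD = separationD[OF s]
    \<comment> \<open>If neither part lay in \<open>X\<close>, each trace would lose at least one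
      rank, but ranks add up over the parts and \<open>X\<close> has only one rank less than
      \<open>G\<close>.\<close>
    have "A \<subseteq> X \<or> B \<subseteq> X"
    proof (rule ccontr)
      assume "\<not> ?thesis"
      then have "X \<inter> A \<subset> A" "X \<inter> B \<subset> B" by blast+
      then have "r (X \<inter> A) < r A" "r (X \<inter> B) < r B"
        by (auto intro!: flat_rank_less flat_Int sD xD)
      moreover have "r (X \<inter> A) + r (X \<inter> B) = r X + r P"
        by (rule separation_restrict[OF s P(2) xD(3)])
      ultimately show False using sD(9) xD(4) by linarith
    qed
    then show thesis using inside s separation_sym by blast
  qed (use that P in blast)
qed

section \<open>Connectedness of contractions\<close>

lemma rank_insert_notin_cl: "e \<in> E \<Longrightarrow> e \<notin> cl X \<Longrightarrow> r (insert e X) = Suc (r X)"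
  using rank_insert_le[of e X] rank_insert_ge[of X e] by (auto simp: mcl_def)

lemma cl_insert_cl:
  assumes "insert e I \<subseteq> E"
  shows "cl (insert e (cl I)) = cl (insert e I)"
proof
  have "insert e (cl I) \<subseteq> cl (insert e I)"
    using subset_cl[OF assms] cl_mono[of I "insert e I"] by blast
  then show "cl (insert e (cl I)) \<subseteq> cl (insert e I)" using cl_least cl_flat[OF assms] by blast
  show "cl (insert e I) \<subseteq> cl (insert e (cl I))"
    by (rule cl_mono) (use subset_cl[of I] assms in blast)
qed

text \<open>Translates independence in the contraction, defined through bases of \<open>L\<close>,
  into the rank function of \<open>M\<close>: every basis of \<open>L\<close> has \<open>r L\<close>
  elements and \<open>L\<close> in its closure.\<close>

lemma contraction_indep_iff:
  assumes L: "L \<subseteq> E" and I: "I \<subseteq> E - L"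
  shows "I \<in> indep (contraction M L) \<longleftrightarrow> r (I \<union> L) = card I + r L"
proof
  assume "I \<in> indep (contraction M L)"
  then obtain B where B: "basis_in M L B" "I \<union> B \<in> indep M" by (auto simp: contraction_def)
  then have "B \<in> indep M" "B \<subseteq> L" by (auto simp: basis_in_def)
  then obtain B' where "B' \<in> indep M" "B \<subseteq> B'" "B' \<subseteq> L" "card B' = r L" by (rule indep_extend)
  then have "card B = r L" using B by (auto simp: basis_in_def)
  have fin: "finite (I \<union> B)" using B finite_indep by blast
  have "card I + r L = card (I \<union> B)"
    using fin \<open>B \<subseteq> L\<close> I \<open>card B = r L\<close> by (subst card_Un_disjoint) auto
  also have "\<dots> = r (I \<union> B)" using B rank_indep by simp
  also have "\<dots> \<le> r (I \<union> L)" using \<open>B \<subseteq> L\<close> by (intro rank_mono) blast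
  finally have "card I + r L \<le> r (I \<union> L)" .
  moreover have "r (I \<union> L) \<le> r I + r L" using rank_submodular[of I L] by simp
  moreover have "r I \<le> card I" using fin by (intro rank_le_card) simp
  ultimately show "r (I \<union> L) = card I + r L" by linarith
next
  assume rk: "r (I \<union> L) = card I + r L"
  obtain B where B: "B \<in> indep M" "B \<subseteq> L" "card B = r L" by (rule rank_attained)
  have "basis_in M L B"
    unfolding basis_in_def
  proof (intro conjI ballI impI B)
    fix J assume J: "J \<in> indep M" "B \<subseteq> J \<and> J \<subseteq> L"
    then have "card J \<le> card B" using card_le_rank[of J L] B by simp
    then show "J = B" using J finite_indep card_seteq by blast
  qed
  have IB: "I \<union> B \<subseteq> E" using I B L by blast
  have "L \<subseteq> cl B"
  proof
    fix e assume e: "e \<in> L"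
    have "r (insert e B) \<le> r L" using e B by (intro rank_mono) blast
    then have "r (insert e B) = r B" using B rank_indep[of B] rank_insert_ge[of B e] by simp
    then show "e \<in> cl B" using e L by (auto simp: mcl_def)
  qed
  then have "I \<union> L \<subseteq> cl (I \<union> B)"
    using subset_cl[OF IB] cl_mono[of B "I \<union> B"] by blast
  then have "r (I \<union> L) \<le> r (I \<union> B)" using rank_mono rank_cl[OF IB] by metis
  moreover have fin: "finite I" "finite B" using IB finite_ground finite_subset by blast+
  moreover have "card (I \<union> B) = card I + card B"
    using fin B I by (subst card_Un_disjoint) auto
  moreover have "r (I \<union> B) \<le> card (I \<union> B)" using fin by (intro rank_le_card) simp
  ultimately have "I \<union> B \<in> indep M" using indep_iff_rank[OF IB] rk B by simp
  then show "I \<in> indep (contraction M L)"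
    using \<open>basis_in M L B\<close> I by (auto simp: contraction_def)
qed

text \<open>Independence in the contraction is hereditary, so minimality need only be tested on
  deletions of one element.\<close>

lemma circuit_contractionI:
  assumes "C \<subseteq> E - L" "C \<notin> indep (contraction M L)"
    and "\<And>x. x \<in> C \<Longrightarrow> C - {x} \<in> indep (contraction M L)"
  shows "circuit (contraction M L) C"
  unfolding circuit_def
proof (intro conjI allI impI assms(2))
  show "C \<subseteq> ground (contraction M L)" using assms(1) by (simp add: contraction_def)
  fix X assume "X \<subset> C"
  then obtain x where "x \<in> C" "X \<subseteq> C - {x}" by blast
  then obtain B where "basis_in M L B" "(C - {x}) \<union> B \<in> indep M" "C - {x} \<subseteq> E - L"
    using assms(3)[of x] by (auto simp: contraction_def)
  moreover have "X \<union> B \<subseteq> (C - {x}) \<union> B" using \<open>X \<subseteq> C - {x}\<close> by blast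
  ultimately show "X \<in> indep (contraction M L)"
    using indep_subset \<open>X \<subseteq> C - {x}\<close> unfolding contraction_def
    by (simp, blast)
qed

text \<open>The contraction has rank 2. Two elements in the same cover of \<open>L\<close> are
  parallel there and form a circuit; two elements in different covers form a triangle with any
  element outside both covers.\<close>

lemma indecomposable_flat_corank2:
  assumes c: "conn L E" and rk: "r L + 2 = r E"
  shows "indecomposable_flat M L"
  unfolding indecomposable_flat_def connected_matroid_def
proof (intro conjI ballI impI)
  let ?N = "contraction M L"
  show L: "L \<in> flats M" using c by (simp add: conn_def)
  note LE = flatsD[OF L]
  fix e f assume "e \<in> ground ?N" "f \<in> ground ?N" and ef: "e \<noteq> f"
  then have e: "e \<in> E" "e \<notin> L" and f: "f \<in> E" "f \<notin> L" by (auto simp: contraction_def)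
  have single: "{x} \<in> indep ?N" if "x \<in> E" "x \<notin> L" for x
    using that contraction_indep_iff[OF LE(1), of "{x}"] rank_insert_notin_cl[of x L] LE by simp
  have pair: "{x, y} \<in> indep ?N" if "x \<in> E" "x \<notin> L" "y \<in> E" "y \<notin> cl (insert x L)" for x y
  proof -
    have xL: "insert x L \<subseteq> cl (insert x L)" using that LE by (intro subset_cl) blast
    then have "x \<noteq> y" "y \<notin> L" using that by auto
    moreover have "r (insert y (insert x L)) = Suc (Suc (r L))"
      using that rank_insert_notin_cl LE by simp
    ultimately show ?thesis
      using that contraction_indep_iff[OF LE(1), of "{x, y}"] by (simp add: insert_commute)
  qed
  show "\<exists>C. circuit ?N C \<and> e \<in> C \<and> f \<in> C"
  proof (cases "f \<in> cl (insert e L)")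
    case True
    then have "r (insert f (insert e L)) \<le> Suc (r L)" using rank_insert_le[of e L] by (simp add: mcl_def)
    then have "{e, f} \<notin> indep ?N"
      using contraction_indep_iff[OF LE(1), of "{e, f}"] e f ef by (simp add: insert_commute)
    then have "circuit ?N {e, f}"
      using e f ef single by (intro circuit_contractionI) (auto simp: insert_Diff_if)
    then show ?thesis by blast
  next
    case False
    let ?A = "cl (insert e L)" and ?B = "cl (insert f L)"
    have A: "covers L ?A" and B: "covers L ?B" using covers_cl_insert L e f by auto
    have "insert e L \<subseteq> E" "insert f L \<subseteq> E" using e f LE by auto
    then have in_cl: "e \<in> ?A" "f \<in> ?B" using subset_cl by blast+
    have "\<not> ?B \<subseteq> ?A" using False in_cl by blast
    then have I: "?B \<inter> ?A = L" using covers_Int_subset[OF B, of ?A] coversD[OF A] by blast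
    \<comment> \<open>Two covers exhausting \<open>E\<close> would be a separation; this is the only
      use of connectedness, and it provides the third element.\<close>
    have "?A \<union> ?B \<noteq> E"
    proof
      assume "?A \<union> ?B = E"
      then have "separation L E ?A ?B"
        using I coversD[OF A] coversD[OF B] ground_flat rk by (simp add: separation_def Int_commute)
      then show False using c by (auto simp: conn_def)
    qed
    then obtain g where g: "g \<in> E" "g \<notin> ?A" "g \<notin> ?B" using cl_ground by blast
    then have g': "g \<notin> L" "g \<noteq> e" "g \<noteq> f" using coversD(3)[OF A] in_cl by auto
    have "r ({e, f, g} \<union> L) \<le> r E" using e f g LE by (intro rank_mono) auto
    then have "{e, f, g} \<notin> indep ?N"
      using contraction_indep_iff[OF LE(1), of "{e, f, g}"] e f g g' ef rk by auto
    moreover have "{e, f} \<in> indep ?N" "{e, g} \<in> indep ?N" "{f, g} \<in> indep ?N"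
      using pair e f g False by auto
    ultimately have "circuit ?N {e, f, g}"
      using e f g g' ef by (intro circuit_contractionI) (auto simp: insert_Diff_if)
    then show ?thesis by blast
  qed
qed

text \<open>A circuit through elements of both parts has independent traces on \<open>A\<close> and
  \<open>B\<close>; ranks add up across a separation, so the circuit would be independent.\<close>

lemma conn_bottom:
  assumes c: "connected_matroid M" and bot: "cl {} = {}"
  shows "conn {} E"
proof -
  have F: "{} \<in> flats M" using bot by (simp add: flats_def)
  have False if s: "separation {} E A B" for A B
  proof -
    note sD = separationD[OF s]
    obtain e f where ef: "e \<in> A" "f \<in> B" using sD(7,8) by blast
    then have "e \<noteq> f" "e \<in> E" "f \<in> E" using sD(6,12,13) by blast+
    then obtain C where C: "circuit M C" "e \<in> C" "f \<in> C"
      using c unfolding connected_matroid_def by blast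
    have CE: "C \<subseteq> E" using C by (simp add: circuit_def)
    have "C \<inter> A \<subset> C" "C \<inter> B \<subset> C" using C(2,3) ef sD(6) by blast+
    then have "C \<inter> A \<in> indep M" "C \<inter> B \<in> indep M" using C by (auto simp: circuit_def)
    then have "r (C \<inter> A) = card (C \<inter> A)" "r (C \<inter> B) = card (C \<inter> B)" using rank_indep by auto
    moreover have "r (C \<inter> A) + r (C \<inter> B) = r C"
      using separation_restrict[OF s _ CE] rank_empty by simp
    moreover have "card (C \<inter> A) + card (C \<inter> B) = card C"
    proof -
      have "finite C" "(C \<inter> A) \<union> (C \<inter> B) = C" "(C \<inter> A) \<inter> (C \<inter> B) = {}"
        using CE finite_ground finite_subset sD(5,6) by blast+
      then show ?thesis by (metis card_Un_disjoint finite_Int)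
    qed
    ultimately have "C \<in> indep M" using indep_iff_rank[OF CE] by simp
    then show False using C by (simp add: circuit_def)
  qed
  then show ?thesis using F ground_flat by (auto simp: conn_def)
qed

end

section \<open>Tutte's path theorem\<close>

locale proper_modular_cut = finite_matroid +
  fixes \<Gamma> :: "'a set set"
  assumes cut: "modular_cut M \<Gamma>" and nonempty: "\<Gamma> \<noteq> {}" and proper: "\<Gamma> \<noteq> flats M"
begin

lemma cut_flat: "F \<in> \<Gamma> \<Longrightarrow> F \<in> flats M"
  using cut by (auto simp: modular_cut_def)

lemma cut_up: "F \<in> \<Gamma> \<Longrightarrow> G \<in> flats M \<Longrightarrow> F \<subseteq> G \<Longrightarrow> G \<in> \<Gamma>"
  using cut by (auto simp: modular_cut_def)

lemma ground_in_cut: "E \<in> \<Gamma>"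
  using nonempty cut_up cut_flat flatsD ground_flat by blast

lemma bottom_notin_cut: "cl {} \<notin> \<Gamma>"
proof
  assume "cl {} \<in> \<Gamma>"
  then have "flats M \<subseteq> \<Gamma>" using cut_up cl_least by blast
  then show False using cut_flat proper by blast
qed

text \<open>Distinct covers of \<open>F\<close> form a modular pair, since their join has rank
  \<open>r F + 2\<close>. Hence a flat off \<Gamma> has at most one cover in \<Gamma>.\<close>

lemma cut_covers_join:
  assumes "covers F P" "covers F Q" "P \<noteq> Q" "P \<in> \<Gamma>" "Q \<in> \<Gamma>"
  shows "F \<in> \<Gamma>"
proof -
  have "\<not> Q \<subseteq> P" using assms(1-3) covers_subset_eq by blast
  then have I: "P \<inter> Q = F"
    using covers_Int_subset[OF assms(2), of P] coversD[OF assms(1)] by blast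
  moreover have "r P + r Q = r (P \<inter> Q) + r (cl (P \<union> Q))"
    using I coversD(4)[OF covers_join[OF assms(1-3)]] coversD(4)[OF assms(1)] coversD(4)[OF assms(2)]
    by simp
  then have "P \<inter> Q \<in> \<Gamma>" using cut assms(4,5) unfolding modular_cut_def by blast
  then show ?thesis using I by simp
qed

definition off_hyperplane :: "'a set \<Rightarrow> bool" where
  "off_hyperplane H \<longleftrightarrow> covers H E \<and> H \<notin> \<Gamma>"

text \<open>The pairs of hyperplanes that span a class 1 element. Indecomposability of the meet is
  kept in the separation form used in the induction; \<open>indecomposable_flat_corank2\<close>
  translates it.\<close>

definition adjacent :: "'a set \<Rightarrow> 'a set \<Rightarrow> bool" where
  "adjacent X Y \<longleftrightarrow> off_hyperplane X \<and> off_hyperplane Y \<and> X \<noteq> Y \<and>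
     covers (X \<inter> Y) X \<and> covers (X \<inter> Y) Y \<and> conn (X \<inter> Y) E"

text \<open>A flat off \<Gamma> that is not yet a hyperplane has two distinct covers, not both in
  \<Gamma>, so one can climb without entering \<Gamma>.\<close>

lemma off_hyperplane_above:
  assumes "F \<in> flats M" "F \<notin> \<Gamma>"
  shows "\<exists>H. off_hyperplane H \<and> F \<subseteq> H"
  using assms
proof (induction "r E - r F" arbitrary: F rule: less_induct)
  case less
  note F = less.prems
  show ?case
  proof (cases "covers F E")
    case False
    have FE: "F \<subseteq> E" using flatsD F by simp
    have "\<not> E \<subseteq> F" using F(2) FE ground_in_cut by (metis subset_antisym)
    then obtain P where P: "covers F P" using covers_exists[OF F(1) ground_flat F(1)] FE by blast
    have "P \<subseteq> E" using coversD[OF P] flatsD by simp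
    then have "\<not> E \<subseteq> P" using P False by (metis subset_antisym)
    then obtain Q where Q: "covers F Q" "\<not> Q \<subseteq> P"
      using covers_exists[OF F(1) ground_flat coversD(2,3)[OF P]] FE by metis
    have up: ?thesis if W: "covers F W" "W \<notin> \<Gamma>" for W
    proof -
      note wD = coversD[OF W(1)]
      have "r W \<le> r E" by (intro rank_mono flatsD wD)
      then have "r E - r W < r E - r F" using wD(4) by linarith
      then obtain H where "off_hyperplane H \<and> W \<subseteq> H"
        using less.hyps wD(2) W(2) by blast
      then show ?thesis using wD(3) by blast
    qed
    show ?thesis using up[OF P] up[OF Q(1)] cut_covers_join[OF P Q(1)] Q(2) F(2) by blast
  qed (use F in \<open>auto simp: off_hyperplane_def\<close>)
qed

lemma tutte_path:
  assumes "conn F E" "off_hyperplane X" "off_hyperplane Y" "F \<subseteq> X" "F \<subseteq> Y"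
  shows "adjacent\<^sup>*\<^sup>* X Y"
  using assms
proof (induction "r E - r F" arbitrary: F X Y rule: less_induct)
  case less
  have F: "F \<in> flats M" using less.prems by (simp add: conn_def)
  have X: "covers X E" "X \<notin> \<Gamma>" and Y: "covers Y E" "Y \<notin> \<Gamma>"
    using less.prems by (auto simp: off_hyperplane_def)
  note xD = coversD[OF X(1)] and yD = coversD[OF Y(1)]
  have rX: "r F \<le> r X" using less.prems rank_mono by blast
  consider "r E \<le> Suc (r F)" | "r E = r F + 2" | "r F + 3 \<le> r E" by linarith
  then show ?case
  proof cases
    case 1
    \<comment> \<open>Corank at most 1 leaves no room between \<open>F\<close> and a hyperplane
      above it.\<close>
    then have "X = F" "Y = F"
      using flat_rank_eq[of F X] flat_rank_eq[of F Y] F xD yD less.prems by auto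
    then show ?thesis by simp
  next
    case 2
    show ?thesis
    proof (cases "X = Y")
      case False
      have c: "covers F X" "covers F Y" using 2 F xD yD less.prems by (auto simp: covers_def)
      then have "\<not> X \<subseteq> Y" using covers_subset_eq False by blast
      then have "X \<inter> Y = F" using covers_Int_subset[OF c(1) yD(1)] less.prems by blast
      then have "adjacent X Y" using c less.prems False by (simp add: adjacent_def)
      then show ?thesis by blast
    qed simp
  next
    case 3
    have rk: "r F + 2 \<le> r E" using 3 by simp
    \<comment> \<open>Induction hypothesis: hyperplanes sharing a connected cover of
      \<open>F\<close> are joined above that cover, where the corank is smaller.\<close>
    have up: "adjacent\<^sup>*\<^sup>* U V"
      if "covers F P" "conn P E" "off_hyperplane U" "off_hyperplane V" "P \<subseteq> U" "P \<subseteq> V" for P U V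
      using less.hyps[of P U V] that coversD(4)[OF that(1)] 3 by auto
    have meet: "adjacent\<^sup>*\<^sup>* U V"
      if "covers F P" "conn P E" "covers F Q" "conn Q E" "off_hyperplane U" "off_hyperplane V"
        "P \<subseteq> U" "Q \<subseteq> V" "cl (P \<union> Q) \<notin> \<Gamma>" for P Q U V
    proof -
      have "P \<union> Q \<subseteq> E" using that(1,3) by (simp add: covers_def flatsD)
      then have J: "cl (P \<union> Q) \<in> flats M" "P \<union> Q \<subseteq> cl (P \<union> Q)"
        using cl_flat subset_cl by blast+
      have "\<exists>Z. off_hyperplane Z \<and> cl (P \<union> Q) \<subseteq> Z" by (rule off_hyperplane_above[OF J(1) that(9)])
      then obtain Z where Z: "off_hyperplane Z" "cl (P \<union> Q) \<subseteq> Z" by blast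
      then have "adjacent\<^sup>*\<^sup>* U Z" "adjacent\<^sup>*\<^sup>* Z V"
        using up[OF that(1,2,5) Z(1) that(7)] up[OF that(3,4) Z(1) that(6) _ that(8)] J by blast+
      then show ?thesis by simp
    qed
    obtain P where P: "covers F P" "P \<subseteq> X" "conn P E"
      by (rule connected_contraction_in_hyperplane[OF less.prems(1) rk X(1) less.prems(4)])
    obtain Q where Q: "covers F Q" "Q \<subseteq> Y" "conn Q E"
      by (rule connected_contraction_in_hyperplane[OF less.prems(1) rk Y(1) less.prems(5)])
    have PQ: "P \<notin> \<Gamma>" "Q \<notin> \<Gamma>" using P Q cut_up xD(1) yD(1) X(2) Y(2) by blast+
    show ?thesis
    proof (cases "P = Q \<or> cl (P \<union> Q) \<notin> \<Gamma>")
      case True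
      then show ?thesis
        using up[OF P(1,3) less.prems(2,3) P(2)] meet[OF P(1,3) Q(1,3) less.prems(2,3) P(2) Q(2)]
          Q(2) by blast
    next
      case False
      let ?J = "cl (P \<union> Q)"
      have J: "?J \<in> \<Gamma>" and PJ: "covers P ?J" and QJ: "covers Q ?J"
        using False covers_join[OF P(1) Q(1)] covers_join[OF Q(1) P(1)] by (auto simp: Un_commute)
      \<comment> \<open>Corank at least 3 enters here: the join of two covers is a proper flat, so a
        connected cover \<open>S\<close> exists outside it.\<close>
      have "r ?J = r F + 2" using PJ P(1) by (simp add: covers_def)
      then have "\<not> E \<subseteq> ?J" using 3 rank_mono[of E ?J] by linarith
      moreover have "F \<subseteq> ?J" using coversD(3)[OF P(1)] coversD(3)[OF PJ] by blast
      ultimately have "\<exists>S T. S \<noteq> T \<and> (\<forall>X\<in>{S, T}. covers F X \<and> X \<subseteq> E \<and> \<not> X \<subseteq> ?J \<and> conn X E)"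
        by (intro connected_contractions_outside less.prems(1) rk coversD(2)[OF PJ])
      then obtain S where S: "covers F S" "\<not> S \<subseteq> ?J" "conn S E"
        by (metis insertI1)
      \<comment> \<open>\<open>?J\<close> and \<open>cl (R \<union> S)\<close> are distinct covers
        of \<open>R\<close>; if both were in \<Gamma>, so would be \<open>R\<close>.\<close>
      have off: "cl (R \<union> S) \<notin> \<Gamma>" if R: "covers F R" "covers R ?J" "R \<notin> \<Gamma>" for R
      proof
        assume "cl (R \<union> S) \<in> \<Gamma>"
        moreover have "R \<noteq> S" using S(2) coversD(3)[OF R(2)] by blast
        then have RS: "covers R (cl (R \<union> S))" using covers_join R S by blast
        moreover have "R \<union> S \<subseteq> E" using R(1) S(1) by (simp add: covers_def flatsD)
        then have "?J \<noteq> cl (R \<union> S)" using S(2) subset_cl[of "R \<union> S"] by blast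
        ultimately show False using cut_covers_join[OF R(2) RS] J R(3) by blast
      qed
      \<comment> \<open>\<open>S\<close> lies below \<open>cl (P \<union> S)\<close>, which is off
        \<Gamma>, and \<Gamma> is closed upwards.\<close>
      have S_above: "S \<in> flats M" "S \<notin> \<Gamma>"
      proof -
        show "S \<in> flats M" using coversD S by blast
        have sub: "P \<union> S \<subseteq> E" using P(1) S(1) by (simp add: covers_def flatsD)
        show "S \<notin> \<Gamma>"
          using off[OF P(1) PJ PQ(1)] cut_up[of S "cl (P \<union> S)"] cl_flat[OF sub] subset_cl[OF sub]
          by blast
      qed
      then obtain Z where Z: "off_hyperplane Z" "S \<subseteq> Z" using off_hyperplane_above by blast
      have "adjacent\<^sup>*\<^sup>* X Z" "adjacent\<^sup>*\<^sup>* Z Y"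
        using meet[OF P(1,3) S(1,3) less.prems(2) Z(1) P(2) Z(2) off[OF P(1) PJ PQ(1)]]
          meet[OF S(1,3) Q(1,3) Z(1) less.prems(3) Z(2) Q(2)] off[OF Q(1) QJ PQ(2)]
        by (auto simp: Un_commute)
      then show ?thesis by simp
    qed
  qed
qed

end

section \<open>Connectivity of order complexes\<close>

lemma topspace_geometric_realization:
  "topspace (geometric_realization K) = (\<Union>C\<in>K. closed_simplex C)"
proof
  have "(\<Union>C\<in>K. closed_simplex C) \<inter> closed_simplex C = closed_simplex C" if "C \<in> K"
    for C :: "'a set"
    using that by blast
  then have "openin (geometric_realization K) (\<Union>C\<in>K. closed_simplex C)"
    by (simp add: openin_geometric_realization) (simp add: openin_subtopology_refl)
  then show "(\<Union>C\<in>K. closed_simplex C) \<subseteq> topspace (geometric_realization K)"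
    by (rule openin_subset)
qed (use openin_geometric_realization[of K "topspace (geometric_realization K)"] in simp)

text \<open>Immediate from the weak topology, whose open sets have open trace on each closed
  simplex.\<close>

lemma continuous_map_closed_simplex:
  assumes "C \<in> K"
  shows "continuous_map (subtopology (powertop_real UNIV) (closed_simplex C)) (geometric_realization K) id"
proof (rule continuous_map_openin_preimage_eq[THEN iffD2], intro conjI allI impI)
  show "id \<in> topspace (subtopology (powertop_real UNIV) (closed_simplex C)) \<rightarrow> topspace (geometric_realization K)"
    using assms by (auto simp: topspace_geometric_realization)
next
  fix U assume "openin (geometric_realization K) U"
  then have "openin (subtopology (powertop_real UNIV) (closed_simplex C)) (U \<inter> closed_simplex C)"
    using assms by (simp add: openin_geometric_realization)
  then show "openin (subtopology (powertop_real UNIV) (closed_simplex C))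
      (topspace (subtopology (powertop_real UNIV) (closed_simplex C)) \<inter> id -` U)"
    by (simp add: Int_commute)
qed

lemma path_component_of_closed_simplex:
  assumes C: "C \<in> K" and x: "x \<in> closed_simplex C" and y: "y \<in> closed_simplex C"
  shows "path_component_of (geometric_realization K) x y"
proof -
  \<comment> \<open>The straight segment in barycentric coordinates, which stays in the simplex by
    convexity.\<close>
  define g where "g t v = (1 - t) * x v + t * y v" for t :: real and v
  have "g t \<in> closed_simplex C" if "t \<in> {0..1}" for t
    using that x y
    by (auto simp: closed_simplex_def g_def sum.distrib simp flip: sum_distrib_left)
  moreover have "continuous_map (top_of_set {0..1}) (powertop_real UNIV) g"
    by (auto simp: continuous_map_componentwise_UNIV g_def intro!: continuous_intros)
  ultimately have "continuous_map (top_of_set {0..1})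
      (subtopology (powertop_real UNIV) (closed_simplex C)) g"
    by (auto simp: continuous_map_in_subtopology)
  then have "pathin (geometric_realization K) (id \<circ> g)"
    unfolding pathin_def
    by (rule continuous_map_compose) (rule continuous_map_closed_simplex[OF C])
  moreover have "g 0 = x" "g 1 = y" by (auto simp: g_def)
  ultimately show ?thesis
    unfolding path_component_of_def by (intro exI[of _ g]) simp
qed

text \<open>Each point is joined to a vertex inside its face, and comparable vertices span a face,
  so zigzags of comparable elements become paths.\<close>

lemma path_connected_order_complex:
  assumes refl: "\<And>v. v \<in> V \<Longrightarrow> rel v v"
    and link: "\<And>u v. u \<in> V \<Longrightarrow> v \<in> V \<Longrightarrow> (\<lambda>u v. u \<in> V \<and> v \<in> V \<and> (rel u v \<or> rel v u))\<^sup>*\<^sup>* u v"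
  shows "path_connected_space (geometric_realization (order_complex V rel))"
proof -
  let ?X = "geometric_realization (order_complex V rel)"
  define pt where "pt v = (\<lambda>u. if u = v then 1 else 0 :: real)" for v :: 'a
  have pt: "pt v \<in> closed_simplex C" if "finite C" "v \<in> C" for v C
    using that by (auto simp: closed_simplex_def pt_def)
  have step: "path_component_of ?X (pt u) (pt v)" if "u \<in> V" "v \<in> V" "rel u v \<or> rel v u" for u v
  proof (rule path_component_of_closed_simplex)
    show "{u, v} \<in> order_complex V rel"
      using that refl by (auto simp: order_complex_def Complete_Partial_Order.chain_def)
  qed (simp_all add: pt)
  have steps: "path_component_of ?X (pt u) (pt v)" if "u \<in> V" "v \<in> V" for u v
    using link[OF that] that(1)
  proof induction
    case base
    then show ?case using step refl by blast
  next
    case (step v w)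
    then show ?case using \<open>\<And>u v. \<lbrakk>u \<in> V; v \<in> V; rel u v \<or> rel v u\<rbrakk> \<Longrightarrow> path_component_of ?X (pt u) (pt v)\<close>
      by (meson path_component_of_trans)
  qed
  have vertex: "\<exists>v\<in>V. path_component_of ?X x (pt v)" if x: "x \<in> topspace ?X" for x
  proof -
    obtain C where C: "C \<in> order_complex V rel" "x \<in> closed_simplex C"
      using x by (auto simp: topspace_geometric_realization)
    then have "finite C" "C \<subseteq> V" by (auto simp: order_complex_def)
    \<comment> \<open>Coordinates over the empty face sum to 0 rather than 1.\<close>
    moreover have "C \<noteq> {}" using C by (auto simp: closed_simplex_def)
    then obtain v where "v \<in> C" by blast
    ultimately show ?thesis
      using path_component_of_closed_simplex[OF C pt[of C v]] by blast
  qed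
  show ?thesis
    unfolding path_connected_space_iff_path_component
  proof (intro ballI)
    fix x y assume "x \<in> topspace ?X" "y \<in> topspace ?X"
    then obtain u v where "u \<in> V" "v \<in> V" "path_component_of ?X x (pt u)" "path_component_of ?X y (pt v)"
      using vertex by meson
    then show "path_component_of ?X x y"
      using steps by (meson path_component_of_sym path_component_of_trans)
  qed
qed

lemma topspace_order_complex_nonempty:
  assumes "v \<in> V" "rel v v"
  shows "topspace (geometric_realization (order_complex V rel)) \<noteq> {}"
proof -
  have "{v} \<in> order_complex V rel"
    using assms by (simp add: order_complex_def Complete_Partial_Order.chain_def)
  moreover have "(\<lambda>u. if u = v then 1 else 0) \<in> closed_simplex {v}"
    by (simp add: closed_simplex_def)
  ultimately show ?thesis unfolding topspace_geometric_realization by blast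
qed

section \<open>Subconstellations of class 0 and 1\<close>

lemma simple_uniform_free: "simple_matroid (uniform_matroid n n)"
proof -
  have "\<exists>e\<in>J - I. insert e I \<subseteq> {..<n} \<and> card (insert e I) \<le> n"
    if "I \<subseteq> {..<n}" "J \<subseteq> {..<n}" "card I < card J" for I J :: "nat set"
  proof -
    have "\<not> J \<subseteq> I" using that card_mono[of I J] finite_subset[of I "{..<n}"] by auto
    then obtain e where "e \<in> J - I" by blast
    moreover from this have "insert e I \<subseteq> {..<n}" using that by blast
    moreover from this have "card (insert e I) \<le> n" using card_mono[of "{..<n}"] by fastforce
    ultimately show ?thesis by blast
  qed
  moreover have "card X \<le> n" if "X \<subseteq> {..<n}" for X using that card_mono[of "{..<n}" X] by simp
  ultimately show ?thesis
    by (auto simp: simple_matroid_def matroid_def uniform_matroid_def)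
qed

text \<open>In the free matroid rank is cardinality, so every new element raises it. Types of class
  0 and 1 are therefore Boolean lattices.\<close>

lemma flats_uniform_free: "flats (uniform_matroid n n) = Pow {..<n}"
proof -
  interpret U: finite_matroid "uniform_matroid n n"
    using simple_uniform_free by unfold_locales (simp add: simple_matroid_def)
  have rk: "U.r X = card X" if "X \<subseteq> {..<n}" for X
    using that card_mono[of "{..<n}" X] by (intro U.rank_indep) (simp add: uniform_matroid_def)
  have "U.cl F = F" if F: "F \<subseteq> {..<n}" for F
  proof -
    have "finite F" using F finite_subset by blast
    then have "U.r (insert e F) = U.r F \<longleftrightarrow> e \<in> F" if "e < n" for e
      using that F rk[of F] rk[of "insert e F"] by (auto simp: insert_absorb card_insert_if)
    then show ?thesis using F by (auto simp: mcl_def uniform_matroid_def)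
  qed
  then show ?thesis by (auto simp: flats_def) (auto simp: uniform_matroid_def)
qed

text \<open>The size is all that is later drawn from the type of a given element: it rules out the
  one-element lattice.\<close>

lemma has_type_uniform_free_card:
  assumes "has_type \<sigma> (uniform_matroid n n)"
  shows "card (fst \<sigma>) = 2 ^ n"
proof -
  obtain \<phi> where "bij_betw \<phi> (fst \<sigma>) (Pow {..<n})"
    using assms unfolding has_type_def flats_uniform_free by blast
  then show ?thesis using bij_betw_same_card by (fastforce simp: card_Pow)
qed

lemma has_type_uniform_freeI:
  assumes im: "\<phi> ` fst \<sigma> = Pow {..<n}"
    and ord: "\<And>F G. F \<in> fst \<sigma> \<Longrightarrow> G \<in> fst \<sigma> \<Longrightarrow> F \<subseteq> G \<longleftrightarrow> \<phi> F \<subseteq> \<phi> G"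
  shows "has_type \<sigma> (uniform_matroid n n)"
proof -
  have "inj_on \<phi> (fst \<sigma>)"
  proof (rule inj_onI)
    fix F G assume "F \<in> fst \<sigma>" "G \<in> fst \<sigma>" "\<phi> F = \<phi> G"
    then show "F = G" using ord[of F G] ord[of G F] by simp
  qed
  then show ?thesis
    using im ord simple_uniform_free by (auto simp: has_type_def flats_uniform_free bij_betw_def)
qed

section \<open>Hyperplanes and upper sublattices\<close>

context finite_matroid
begin

lemma upper_sublattice_hyperplane:
  assumes H: "covers H E"
  shows "upper_sublattice M {H, E}"
proof -
  note hD = coversD[OF H]
  obtain I where I: "I \<in> indep M" "I \<subseteq> H" "card I = r H" by (rule rank_attained)
  have IE: "I \<subseteq> E" using I indep_ground by blast
  have clI: "cl I = H"
    using I rank_cl[OF IE] rank_indep[OF I(1)] cl_least[OF hD(1) I(2)] cl_flat[OF IE]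
    by (intro flat_rank_eq hD) auto
  obtain e where e: "e \<in> E" "e \<notin> H" using hD(3,5) by blast
  have clIe: "cl (insert e I) = E"
    using covers_eq_cl[OF H e] cl_insert_cl[of e I] clI IE e by simp
  \<comment> \<open>Removing everything outside \<open>insert e I\<close> leaves only two sets
    \<open>S\<close> to close up, \<open>I\<close> and \<open>insert e I\<close>.\<close>
  have ground: "E - (E - insert e I) = insert e I" using IE e by blast
  have "{mcl M S | S. I \<subseteq> S \<and> S \<subseteq> insert e I} = {H, E}"
  proof -
    have "S = I \<or> S = insert e I" if "I \<subseteq> S" "S \<subseteq> insert e I" for S using that by blast
    then have "{mcl M S | S. I \<subseteq> S \<and> S \<subseteq> insert e I} = cl ` {I, insert e I}" by blast
    then show ?thesis using clI clIe by simp
  qed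
  moreover have "I \<inter> (E - insert e I) = {}" "spanning M (E - (E - insert e I))"
    unfolding ground spanning_def using IE e clIe by auto
  ultimately show ?thesis
    unfolding upper_sublattice_def using I(1) IE ground
    by (intro exI[of _ I] exI[of _ "E - insert e I"]) simp
qed

lemma upper_sublattice_corank2:
  assumes X: "covers X E" "covers (X \<inter> Y) X" and Y: "covers Y E" "covers (X \<inter> Y) Y" and XY: "X \<noteq> Y"
  shows "upper_sublattice M {X \<inter> Y, X, Y, E}"
proof -
  let ?L = "X \<inter> Y"
  have L: "?L \<in> flats M" using coversD X by blast
  obtain I where I: "I \<in> indep M" "I \<subseteq> ?L" "card I = r ?L" by (rule rank_attained)
  have IE: "I \<subseteq> E" using I indep_ground by blast
  have clI: "cl I = ?L"
    using I rank_cl[OF IE] rank_indep[OF I(1)] cl_least[OF L I(2)] cl_flat[OF IE]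
    by (intro flat_rank_eq L) auto
  have XE: "X \<subseteq> E" "Y \<subseteq> E" using coversD(3) X Y by blast+
  obtain x where x: "x \<in> X" "x \<notin> Y" using covers_subset_eq[OF X(2) Y(2)] XY by blast
  obtain y where y: "y \<in> Y" "y \<notin> X" using covers_subset_eq[OF Y(2) X(2)] XY by blast
  have sub: "insert x I \<subseteq> E" "insert y I \<subseteq> E" "insert y (insert x I) \<subseteq> E" using IE XE x y by auto
  have clx: "cl (insert x I) = X"
    using covers_eq_cl[OF X(2) x(1)] x(2) cl_insert_cl[OF sub(1)] clI by simp
  have cly: "cl (insert y I) = Y"
    using covers_eq_cl[OF Y(2) y(1)] y(2) cl_insert_cl[OF sub(2)] clI by simp
  have clxy: "cl (insert y (insert x I)) = E"
    using covers_eq_cl[OF X(1) _ y(2)] y(1) XE(2) cl_insert_cl[OF sub(3)] clx by auto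
  \<comment> \<open>\<open>?B\<close> is a basis of \<open>M\<close> extending the basis
    \<open>I\<close> of the meet, so the four sets between them close up to the four flats.\<close>
  let ?B = "insert y (insert x I)"
  have ground: "E - (E - ?B) = ?B" using sub(3) by blast
  have "{mcl M S | S. I \<subseteq> S \<and> S \<subseteq> ?B} = {?L, X, Y, E}"
  proof -
    have "S = I \<or> S = insert x I \<or> S = insert y I \<or> S = ?B" if "I \<subseteq> S" "S \<subseteq> ?B" for S
      using that by blast
    then have "{mcl M S | S. I \<subseteq> S \<and> S \<subseteq> ?B} = cl ` {I, insert x I, insert y I, ?B}" by blast
    then show ?thesis by (simp only: image_insert image_empty clI clx cly clxy)
  qed
  moreover have "I \<inter> (E - ?B) = {}" "spanning M (E - (E - ?B))"
    unfolding ground spanning_def using sub clxy by auto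
  ultimately show ?thesis
    unfolding upper_sublattice_def using I(1) IE ground
    by (intro exI[of _ I] exI[of _ "E - ?B"]) simp
qed

text \<open>Extend \<open>I\<close> to a basis \<open>B\<close> of \<open>M\<close> inside the
  spanning set \<open>E - J\<close>; dropping an element of \<open>B - I\<close> leaves a set
  between \<open>I\<close> and \<open>E - J\<close> whose closure is a hyperplane.\<close>

lemma upper_sublattice_contains_hyperplane:
  assumes L: "upper_sublattice M L" and card: "card L \<ge> 2"
  shows "E \<in> L \<and> (\<exists>H\<in>L. covers H E)"
proof -
  obtain I J where I: "I \<in> indep M" "I \<inter> J = {}" and span: "spanning M (E - J)"
    and L_def: "L = {cl S | S. I \<subseteq> S \<and> S \<subseteq> E - J}"
    using L unfolding upper_sublattice_def by blast
  have sub: "I \<subseteq> E - J" using indep_ground[OF I(1)] I(2) by blast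
  have clJ: "cl (E - J) = E" using span by (simp add: spanning_def)
  obtain B where B: "B \<in> indep M" "I \<subseteq> B" "B \<subseteq> E - J" "card B = r (E - J)"
    by (rule indep_extend[OF I(1) sub])
  have BE: "B \<subseteq> E" "finite B" using B(1) indep_ground finite_indep by auto
  have rB: "r B = r E"
    using rank_indep[OF B(1)] B(4) rank_cl[of "E - J"] clJ by simp
  have E_eq: "E = F" if "F \<in> flats M" "r E \<le> r F" for F
    using flat_rank_eq[OF that(1) ground_flat flatsD(1)[OF that(1)] that(2)] by simp
  \<comment> \<open>If \<open>I\<close> were a basis, every admissible \<open>S\<close> would span
    and the lattice would be \<open>{E}\<close>.\<close>
  have "I \<noteq> B"
  proof
    assume "I = B"
    have "cl S = E" if "I \<subseteq> S" "S \<subseteq> E - J" for S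
    proof -
      have "S \<subseteq> E" using that by blast
      then show ?thesis
        using E_eq[of "cl S"] cl_flat[of S] rank_cl[of S] rank_mono[of B S] rB that(1) \<open>I = B\<close> by simp
    qed
    then have "L \<subseteq> {E}" unfolding L_def by blast
    then show False using card card_mono[of "{E}" L] by simp
  qed
  then obtain b where b: "b \<in> B" "b \<notin> I" using B(2) by blast
  let ?C = "B - {b}"
  have C: "?C \<in> indep M" "?C \<subseteq> E" using indep_subset[OF B(1)] BE by auto
  have "r (cl ?C) = card B - 1" using rank_cl[OF C(2)] rank_indep[OF C(1)] b BE by simp
  moreover have "card B > 0" using b BE card_gt_0_iff by blast
  ultimately have "r E = Suc (r (cl ?C))" using rank_indep[OF B(1)] rB by simp
  then have "covers (cl ?C) E"
    using cl_flat[OF C(2)] ground_flat cl_ground by (simp add: covers_def)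
  moreover have "I \<subseteq> ?C" "?C \<subseteq> E - J" using B b by auto
  then have "cl ?C \<in> L" unfolding L_def by blast
  moreover have "cl (E - J) \<in> L" unfolding L_def using sub by blast
  ultimately show ?thesis using clJ by auto
qed

end

section \<open>From hyperplanes and adjacent pairs to vertices of the complex\<close>

context proper_modular_cut
begin

lemma class0_hyperplane:
  assumes H: "off_hyperplane H"
  shows "class0 M (flats M, \<Gamma>) ({H, E}, {E})"
proof -
  have c: "covers H E" "H \<notin> \<Gamma>" using H by (auto simp: off_hyperplane_def)
  note hD = coversD[OF c(1)]
  define \<phi> where "\<phi> F = (if F = H then {} else {0::nat})" for F
  have v: "\<phi> H = {}" "\<phi> E = {0}" using hD(5) by (auto simp: \<phi>_def)
  have "has_type ({H, E}, {E}) (uniform_matroid 1 1)"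
  proof (rule has_type_uniform_freeI)
    show "\<phi> ` fst ({H, E}, {E}) = Pow {..<1}"
      by (simp add: v lessThan_Suc) blast
    show "F \<subseteq> G \<longleftrightarrow> \<phi> F \<subseteq> \<phi> G" if "F \<in> fst ({H, E}, {E})" "G \<in> fst ({H, E}, {E})" for F G
      using that hD(3,5) v unfolding fst_conv by (elim insertE emptyE) auto
  qed
  then show ?thesis
    using upper_sublattice_hyperplane c ground_in_cut
    by (auto simp: class0_def subconstellation_def)
qed

lemma class1_adjacent:
  assumes XY: "adjacent X Y"
  shows "class1 M (flats M, \<Gamma>) ({X \<inter> Y, X, Y, E}, {E})"
proof -
  have X: "covers X E" "covers (X \<inter> Y) X" "X \<notin> \<Gamma>" and Y: "covers Y E" "covers (X \<inter> Y) Y" "Y \<notin> \<Gamma>"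
    and ne: "X \<noteq> Y" and c: "conn (X \<inter> Y) E"
    using XY by (auto simp: adjacent_def off_hyperplane_def)
  let ?L = "X \<inter> Y"
  have sub: "\<not> X \<subseteq> Y" "\<not> Y \<subseteq> X" "X \<subseteq> E" "Y \<subseteq> E" "X \<noteq> E" "Y \<noteq> E"
    using covers_subset_eq[OF X(2) Y(2)] covers_subset_eq[OF Y(2) X(2)] ne
      coversD[OF X(1)] coversD[OF Y(1)] by auto
  then have dist: "?L \<noteq> X" "?L \<noteq> Y" "?L \<noteq> E" by blast+
  \<comment> \<open>The two hyperplanes go to the singletons; the last branch is the value at
    \<open>E\<close>.\<close>
  define \<phi> where "\<phi> F = (if F = ?L then {} else if F = X then {0::nat} else if F = Y then {1} else {0, 1})" for F
  have v: "\<phi> ?L = {}" "\<phi> X = {0}" "\<phi> Y = {1}" "\<phi> E = {0, 1}"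
    using dist ne sub(5,6) by (auto simp: \<phi>_def)
  have "has_type ({?L, X, Y, E}, {E}) (uniform_matroid 2 2)"
  proof (rule has_type_uniform_freeI)
    have "{..<2::nat} = {0, 1}" by auto
    then have "Pow {..<2} = {{}, {0::nat}, {1}, {0, 1}}" by (simp add: Pow_insert) blast
    then show "\<phi> ` fst ({?L, X, Y, E}, {E}) = Pow {..<2}"
      by (simp only: fst_conv image_insert image_empty v)
    have order: "\<not> E \<subseteq> X" "\<not> E \<subseteq> Y" "\<not> X \<subseteq> ?L" "\<not> Y \<subseteq> ?L" "\<not> E \<subseteq> ?L"
      "?L \<subseteq> X" "?L \<subseteq> Y" "?L \<subseteq> E" using sub by blast+
    show "F \<subseteq> G \<longleftrightarrow> \<phi> F \<subseteq> \<phi> G"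
      if "F \<in> fst ({?L, X, Y, E}, {E})" "G \<in> fst ({?L, X, Y, E}, {E})" for F G
      using that order sub(1-4) unfolding fst_conv
      by (elim insertE emptyE) (simp_all only: v, simp_all)
  qed
  moreover have "?L \<notin> \<Gamma>" using cut_up[of ?L X] coversD[OF X(2)] X(3) by blast
  then have "{E} = \<Gamma> \<inter> {?L, X, Y, E}" using X(3) Y(3) ground_in_cut by blast
  moreover have "upper_sublattice M {?L, X, Y, E}"
    by (rule upper_sublattice_corank2[OF X(1,2) Y(1,2) ne])
  moreover have "indecomposable_flat M ?L"
    using coversD(4)[OF X(1)] coversD(4)[OF X(2)] by (intro indecomposable_flat_corank2 c) simp
  ultimately show ?thesis
    using sub by (auto simp: class1_def subconstellation_def)
qed

text \<open>The lattice has at least two elements, hence contains a hyperplane; it is off \<Gamma>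
  because \<open>E\<close> is the only member of \<Gamma> in the lattice.\<close>

lemma X1_contains_hyperplane:
  assumes "\<sigma> \<in> X1 M (flats M, \<Gamma>)"
  shows "\<exists>H. off_hyperplane H \<and> {H, E} \<subseteq> fst \<sigma>"
proof -
  have s: "upper_sublattice M (fst \<sigma>)" "snd \<sigma> = \<Gamma> \<inter> fst \<sigma>" "snd \<sigma> = {E}"
    and "has_type \<sigma> (uniform_matroid 1 1) \<or> has_type \<sigma> (uniform_matroid 2 2)"
    using assms by (auto simp: X1_def class0_def class1_def subconstellation_def)
  then have "card (fst \<sigma>) = 2 ^ 1 \<or> card (fst \<sigma>) = 2 ^ 2"
    using has_type_uniform_free_card by blast
  then have "card (fst \<sigma>) \<ge> 2" by auto
  then obtain H where H: "H \<in> fst \<sigma>" "covers H E" "E \<in> fst \<sigma>"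
    using upper_sublattice_contains_hyperplane s(1) by blast
  moreover have "H \<notin> \<Gamma>" using coversD(5)[OF H(2)] H(1) s(2,3) by blast
  ultimately show ?thesis by (auto simp: off_hyperplane_def)
qed

lemma X1_linked:
  assumes c: "conn (cl {}) E" and s: "\<sigma> \<in> X1 M (flats M, \<Gamma>)" "\<sigma>' \<in> X1 M (flats M, \<Gamma>)"
  defines "R \<equiv> \<lambda>\<rho> \<rho>'. \<rho> \<in> X1 M (flats M, \<Gamma>) \<and> \<rho>' \<in> X1 M (flats M, \<Gamma>) \<and>
    (subconstellation_le \<rho> \<rho>' \<or> subconstellation_le \<rho>' \<rho>)"
  shows "R\<^sup>*\<^sup>* \<sigma> \<sigma>'"
proof -
  let ?v = "\<lambda>H. ({H, E}, {E})"
  have v: "?v H \<in> X1 M (flats M, \<Gamma>)" if "off_hyperplane H" for H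
    using class0_hyperplane[OF that] by (simp add: X1_def)
  \<comment> \<open>The class 1 element spanned by an adjacent pair lies above both class 0
    elements.\<close>
  have step: "R\<^sup>*\<^sup>* (?v X) (?v Y)" if XY: "adjacent X Y" for X Y
  proof -
    let ?w = "({X \<inter> Y, X, Y, E}, {E})"
    have "?w \<in> X1 M (flats M, \<Gamma>)" using class1_adjacent[OF XY] by (simp add: X1_def)
    then have "R (?v X) ?w" "R ?w (?v Y)"
      using v XY by (auto simp: R_def adjacent_def subconstellation_le_def)
    then show ?thesis by (meson rtranclp.rtrancl_refl rtranclp.rtrancl_into_rtrancl)
  qed
  obtain H where H: "off_hyperplane H" "{H, E} \<subseteq> fst \<sigma>" using X1_contains_hyperplane s by blast
  obtain H' where H': "off_hyperplane H'" "{H', E} \<subseteq> fst \<sigma>'" using X1_contains_hyperplane s by blast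
  have "cl {} \<subseteq> H" "cl {} \<subseteq> H'"
    using H(1) H'(1) by (simp_all add: off_hyperplane_def covers_def cl_least)
  then have "adjacent\<^sup>*\<^sup>* H H'" using tutte_path[OF c H(1) H'(1)] by blast
  then have "R\<^sup>*\<^sup>* (?v H) (?v H')"
  proof induction
    case (step X Y)
    then show ?case using \<open>\<And>X Y. adjacent X Y \<Longrightarrow> R\<^sup>*\<^sup>* (?v X) (?v Y)\<close> by (meson rtranclp_trans)
  qed simp
  moreover have "R \<sigma> (?v H)" "R (?v H') \<sigma>'"
    using s v H H' by (auto simp: R_def subconstellation_le_def)
  ultimately show ?thesis by (meson converse_rtranclp_into_rtranclp rtranclp.rtrancl_into_rtrancl)
qed

end

theorem theorem4p2:
  fixes M :: "'a matroid_data" and \<Lambda> \<Gamma> :: "'a set set"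
  assumes "tutte_constellation M (\<Lambda>, \<Gamma>)"
    and "indecomposable M (\<Lambda>, \<Gamma>)"
    and "\<Gamma> \<noteq> {}" and "\<Gamma> \<noteq> \<Lambda>"
  shows "homology_group 0 (geometric_realization (Sigma1 M (\<Lambda>, \<Gamma>))) \<cong> integer_group"
proof -
  have simple: "simple_matroid M" and \<Lambda>: "\<Lambda> = flats M" and cut: "modular_cut M \<Gamma>"
    and con: "connected_matroid M"
    using assms(1,2) by (auto simp: tutte_constellation_def indecomposable_def)
  interpret proper_modular_cut M \<Gamma>
    using simple cut assms(3,4) \<Lambda> by unfold_locales (auto simp: simple_matroid_def)
  \<comment> \<open>A simple matroid has no loops, so its bottom flat is empty, as
    \<open>conn_bottom\<close> requires.\<close>
  have "{e} \<in> indep M" if "e \<in> E" for e using simple that by (simp add: simple_matroid_def)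
  then have bot: "cl {} = {}" using rank_indep rank_empty by (fastforce simp: mcl_def)
  have c: "conn (cl {}) E" using conn_bottom[OF con bot] bot by simp
  obtain H where "off_hyperplane H"
    using off_hyperplane_above[of "cl {}"] cl_flat[of "{}"] bottom_notin_cut by blast
  then have v: "({H, E}, {E}) \<in> X1 M (\<Lambda>, \<Gamma>)"
    using class0_hyperplane \<Lambda> by (simp add: X1_def)
  have refl: "subconstellation_le \<sigma> \<sigma>" for \<sigma> :: "'a constellation"
    by (simp add: subconstellation_le_def)
  show ?thesis
  \<comment> \<open>Zeroth homology of a nonempty path-connected space is infinite cyclic.\<close>
  proof (rule isomorphic_integer_zeroth_homology_group)
    show "path_connected_space (geometric_realization (Sigma1 M (\<Lambda>, \<Gamma>)))"
      unfolding Sigma1_def \<Lambda> by (intro path_connected_order_complex refl X1_linked c)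
    show "topspace (geometric_realization (Sigma1 M (\<Lambda>, \<Gamma>))) \<noteq> {}"
      unfolding Sigma1_def by (rule topspace_order_complex_nonempty[OF v refl])
  qed
qed

end
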